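(* Let $(U,\mu)$ be an algebra in a symmetric tensor category $\mathcal{C}$ over a field $\mathbb{F}$, let $Q$ be a quadratic form on $U$ and $B$ the associated symmetric bilinear form. Let $\hat\mu$ and $\tilde\mu$ be the multiplications induced by $\mu$ on $U\otimes U$ and on $\Gamma^2(U)$, and write $c=c_{U,U}$. Suppose that either - the characteristic of $\mathbb{F}$ is not $2$, or - the characteristic of $\mathbb{F}$ is $2$ and the Frobenius twist of $U$ is trivial: $U^{(1)}=0$. Then the full linearization $B\otimes B=B\circ\hat\mu\circ\bigl((\mathrm{id}+c)\otimes\mathrm{id}\bigr)$ (as morphisms $U^{\otimes 4}\to\mathbf{1}$) implies the multiplicative property of $Q$: $Q\otimes Q=Q\circ\tilde\mu$.
   Context: $\mathcal{C}$ is a symmetric tensor category over $\mathbb{F}$ with unit object $\mathbf{1}$ and braiding $c_{U,V}:U\otimes V\to V\otimes U$. For an object $U$, $(\Gamma^2(U),\iota_U)$ is the kernel of $\mathrm{id}-c_{U,U}:U\otimes U\to U\otimes U$, and $\rho_U:U\otimes U\to\Gamma^2(U)$ is the unique morphism with $\iota_U\circ\rho_U=\mathrm{id}+c_{U,U}$ (it exists since $c_{U,U}^2=\mathrm{id}$). A quadratic form on $U$ is a morphism $Q:\Gamma^2(U)\to\mathbf{1}$; its associated bilinear form is $B=Q\circ\rho_U:U\otimes U\to\mathbf{1}$. An algebra $(U,\mu)$ is an object with a morphism $\mu:U\otimes U\to U$ (no associativity assumed). The induced multiplication on $U\otimes U$ is $\hat\mu=(\mu\otimes\mu)\circ(\mathrm{id}_U\otimes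 c_{U,U}\otimes\mathrm{id}_U)$, and $\tilde\mu:\Gamma^2(U)\otimes\Gamma^2(U)\to\Gamma^2(U)$ is the unique morphism with $\iota_U\circ\tilde\mu=\hat\mu\circ(\iota_U\otimes\iota_U)$. In characteristic $2$, let $(S^2(U),\pi_U)$ be the cokernel of $\mathrm{id}-c_{U,U}$; the Frobenius twist $U^{(1)}$ is the image of $\pi_U\circ\iota_U:\Gamma^2(U)\to S^2(U)$. Associativity and unit isomorphisms are suppressed. *)

theory Defs
  imports Main
begin

text \<open>
  Symmetric tensor categories over a field, in the sense of Etingof, Gelaki, Nikshych and Ostrik:
  locally finite abelian \<open>k\<close>-linear rigid symmetric monoidal categories with bilinear tensor product
  and \<open>End(\<one>) = k\<close>. The monoidal structure is not assumed to be strict.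

  Objects are the elements of the type \<open>'o\<close> and morphisms (of all hom spaces together) the
  elements of \<open>'m\<close>. Sums and composites of morphisms that do not fit together are unspecified.
\<close>

record ('k, 'o, 'm) tensor_category_data =
  Dom :: "'m \<Rightarrow> 'o"
  Cod :: "'m \<Rightarrow> 'o"
  ident :: "'o \<Rightarrow> 'm"
  comp :: "'m \<Rightarrow> 'm \<Rightarrow> 'm" (infixr \<open>\<cdot>\<index>\<close> 70)
  zero_mor :: "'o \<Rightarrow> 'o \<Rightarrow> 'm"
  add_mor :: "'m \<Rightarrow> 'm \<Rightarrow> 'm" (infixl \<open>\<oplus>\<index>\<close> 65)
  scale :: "'k \<Rightarrow> 'm \<Rightarrow> 'm" (infixr \<open>\<star>\<index>\<close> 80)
  tensor_obj :: "'o \<Rightarrow> 'o \<Rightarrow> 'o" (infixl \<open>\<odot>\<index>\<close> 75)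
  tensor_mor :: "'m \<Rightarrow> 'm \<Rightarrow> 'm" (infixl \<open>\<otimes>\<index>\<close> 75)
  unit_obj :: 'o (\<open>\<one>\<index>\<close>)
  assoc :: "'o \<Rightarrow> 'o \<Rightarrow> 'o \<Rightarrow> 'm"
  lunit :: "'o \<Rightarrow> 'm"
  runit :: "'o \<Rightarrow> 'm"
  braid :: "'o \<Rightarrow> 'o \<Rightarrow> 'm"

definition hom :: "('k, 'o, 'm) tensor_category_data \<Rightarrow> 'o \<Rightarrow> 'o \<Rightarrow> 'm set" where
  "hom C a b = {f. Dom C f = a \<and> Cod C f = b}"

definition diff_mor :: "('k::field, 'o, 'm) tensor_category_data \<Rightarrow> 'm \<Rightarrow> 'm \<Rightarrow> 'm"
    (infixl \<open>\<ominus>\<index>\<close> 65) where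
  "f \<ominus>\<^bsub>C\<^esub> g = f \<oplus>\<^bsub>C\<^esub> ((- 1) \<star>\<^bsub>C\<^esub> g)"


subsection \<open>Linear and abelian categories\<close>

locale category =
  fixes C :: "('k::field, 'o, 'm) tensor_category_data" (structure)
  assumes ident_hom: "ident C a \<in> hom C a a"
    and comp_hom: "\<lbrakk>g \<in> hom C b c; f \<in> hom C a b\<rbrakk> \<Longrightarrow> g \<cdot> f \<in> hom C a c"
    and comp_assoc: "\<lbrakk>h \<in> hom C c d; g \<in> hom C b c; f \<in> hom C a b\<rbrakk>
          \<Longrightarrow> (h \<cdot> g) \<cdot> f = h \<cdot> (g \<cdot> f)"
    and ident_left: "f \<in> hom C a b \<Longrightarrow> ident C b \<cdot> f = f"
    and ident_right: "f \<in> hom C a b \<Longrightarrow> f \<cdot> ident C a = f"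

locale linear_category = category +
  assumes zero_hom: "zero_mor C a b \<in> hom C a b"
    and add_hom: "\<lbrakk>f \<in> hom C a b; g \<in> hom C a b\<rbrakk> \<Longrightarrow> f \<oplus> g \<in> hom C a b"
    and scale_hom: "f \<in> hom C a b \<Longrightarrow> r \<star> f \<in> hom C a b"
    and add_assoc: "\<lbrakk>f \<in> hom C a b; g \<in> hom C a b; h \<in> hom C a b\<rbrakk>
          \<Longrightarrow> (f \<oplus> g) \<oplus> h = f \<oplus> (g \<oplus> h)"
    and add_comm: "\<lbrakk>f \<in> hom C a b; g \<in> hom C a b\<rbrakk> \<Longrightarrow> f \<oplus> g = g \<oplus> f"
    and zero_left: "f \<in> hom C a b \<Longrightarrow> zero_mor C a b \<oplus> f = f"
    and neg_exists: "f \<in> hom C a b \<Longrightarrow> \<exists>g \<in> hom C a b. f \<oplus> g = zero_mor C a b"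
    and scale_add_right: "\<lbrakk>f \<in> hom C a b; g \<in> hom C a b\<rbrakk>
          \<Longrightarrow> r \<star> (f \<oplus> g) = (r \<star> f) \<oplus> (r \<star> g)"
    and scale_add_left: "f \<in> hom C a b \<Longrightarrow> (r + s) \<star> f = (r \<star> f) \<oplus> (s \<star> f)"
    and scale_scale: "f \<in> hom C a b \<Longrightarrow> r \<star> (s \<star> f) = (r * s) \<star> f"
    and scale_one: "f \<in> hom C a b \<Longrightarrow> 1 \<star> f = f"
    and comp_add_left: "\<lbrakk>g \<in> hom C b c; h \<in> hom C b c; f \<in> hom C a b\<rbrakk>
          \<Longrightarrow> (g \<oplus> h) \<cdot> f = (g \<cdot> f) \<oplus> (h \<cdot> f)"
    and comp_add_right: "\<lbrakk>g \<in> hom C b c; f \<in> hom C a b; h \<in> hom C a b\<rbrakk>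
          \<Longrightarrow> g \<cdot> (f \<oplus> h) = (g \<cdot> f) \<oplus> (g \<cdot> h)"
    and comp_scale_left: "\<lbrakk>g \<in> hom C b c; f \<in> hom C a b\<rbrakk>
          \<Longrightarrow> (r \<star> g) \<cdot> f = r \<star> (g \<cdot> f)"
    and comp_scale_right: "\<lbrakk>g \<in> hom C b c; f \<in> hom C a b\<rbrakk>
          \<Longrightarrow> g \<cdot> (r \<star> f) = r \<star> (g \<cdot> f)"

definition mono_mor :: "('k, 'o, 'm) tensor_category_data \<Rightarrow> 'm \<Rightarrow> bool" where
  "mono_mor C f \<longleftrightarrow> (\<forall>g h. Dom C g = Dom C h \<and> Cod C g = Dom C f \<and> Cod C h = Dom C f
      \<and> f \<cdot>\<^bsub>C\<^esub> g = f \<cdot>\<^bsub>C\<^esub> h \<longrightarrow> g = h)"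

definition epi_mor :: "('k, 'o, 'm) tensor_category_data \<Rightarrow> 'm \<Rightarrow> bool" where
  "epi_mor C f \<longleftrightarrow> (\<forall>g h. Cod C g = Cod C h \<and> Dom C g = Cod C f \<and> Dom C h = Cod C f
      \<and> g \<cdot>\<^bsub>C\<^esub> f = h \<cdot>\<^bsub>C\<^esub> f \<longrightarrow> g = h)"

definition inverse_mors :: "('k, 'o, 'm) tensor_category_data \<Rightarrow> 'm \<Rightarrow> 'm \<Rightarrow> bool" where
  "inverse_mors C f g \<longleftrightarrow> Dom C g = Cod C f \<and> Cod C g = Dom C f
      \<and> g \<cdot>\<^bsub>C\<^esub> f = ident C (Dom C f) \<and> f \<cdot>\<^bsub>C\<^esub> g = ident C (Cod C f)"

definition iso_mor :: "('k, 'o, 'm) tensor_category_data \<Rightarrow> 'm \<Rightarrow> bool" where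
  "iso_mor C f \<longleftrightarrow> (\<exists>g. inverse_mors C f g)"

definition inv_mor :: "('k, 'o, 'm) tensor_category_data \<Rightarrow> 'm \<Rightarrow> 'm" where
  "inv_mor C f = (THE g. inverse_mors C f g)"

definition zero_object :: "('k, 'o, 'm) tensor_category_data \<Rightarrow> 'o \<Rightarrow> bool" where
  "zero_object C z \<longleftrightarrow> (\<forall>a. (\<exists>!f. f \<in> hom C z a) \<and> (\<exists>!f. f \<in> hom C a z))"

definition is_kernel :: "('k, 'o, 'm) tensor_category_data \<Rightarrow> 'm \<Rightarrow> 'm \<Rightarrow> bool" where
  "is_kernel C f k \<longleftrightarrow> Cod C k = Dom C f \<and> f \<cdot>\<^bsub>C\<^esub> k = zero_mor C (Dom C k) (Cod C f)
      \<and> (\<forall>g. Cod C g = Dom C f \<and> f \<cdot>\<^bsub>C\<^esub> g = zero_mor C (Dom C g) (Cod C f)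
          \<longrightarrow> (\<exists>!h. h \<in> hom C (Dom C g) (Dom C k) \<and> k \<cdot>\<^bsub>C\<^esub> h = g))"

definition is_cokernel :: "('k, 'o, 'm) tensor_category_data \<Rightarrow> 'm \<Rightarrow> 'm \<Rightarrow> bool" where
  "is_cokernel C f q \<longleftrightarrow> Dom C q = Cod C f \<and> q \<cdot>\<^bsub>C\<^esub> f = zero_mor C (Dom C f) (Cod C q)
      \<and> (\<forall>g. Dom C g = Cod C f \<and> g \<cdot>\<^bsub>C\<^esub> f = zero_mor C (Dom C f) (Cod C g)
          \<longrightarrow> (\<exists>!h. h \<in> hom C (Cod C q) (Cod C g) \<and> h \<cdot>\<^bsub>C\<^esub> q = g))"

text \<open>The image is the kernel of the cokernel; it is represented by its inclusion morphism.\<close>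

definition is_image :: "('k, 'o, 'm) tensor_category_data \<Rightarrow> 'm \<Rightarrow> 'm \<Rightarrow> bool" where
  "is_image C f j \<longleftrightarrow> (\<exists>q. is_cokernel C f q \<and> is_kernel C q j)"

locale abelian_linear_category = linear_category +
  assumes zero_object_exists: "\<exists>z. zero_object C z"
    and direct_sum_exists: "\<exists>s. \<exists>i\<in>hom C a s. \<exists>j\<in>hom C b s. \<exists>p\<in>hom C s a. \<exists>q\<in>hom C s b.
          p \<cdot> i = ident C a \<and> q \<cdot> j = ident C b \<and> (i \<cdot> p) \<oplus> (j \<cdot> q) = ident C s"
    and kernel_exists: "\<exists>k. is_kernel C f k"
    and cokernel_exists: "\<exists>q. is_cokernel C f q"
    and mono_is_kernel: "mono_mor C i \<Longrightarrow> \<exists>f. is_kernel C f i"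
    and epi_is_cokernel: "epi_mor C p \<Longrightarrow> \<exists>f. is_cokernel C f p"

inductive_set hom_span :: "('k, 'o, 'm) tensor_category_data \<Rightarrow> 'o \<Rightarrow> 'o \<Rightarrow> 'm set \<Rightarrow> 'm set"
  for C :: "('k, 'o, 'm) tensor_category_data" and a b :: 'o and S :: "'m set" where
  span_zero: "zero_mor C a b \<in> hom_span C a b S"
| span_add_scale: "\<lbrakk>f \<in> hom_span C a b S; g \<in> S\<rbrakk>
    \<Longrightarrow> f \<oplus>\<^bsub>C\<^esub> (r \<star>\<^bsub>C\<^esub> g) \<in> hom_span C a b S"

definition simple_object :: "('k, 'o, 'm) tensor_category_data \<Rightarrow> 'o \<Rightarrow> bool" where
  "simple_object C s \<longleftrightarrow> \<not> zero_object C s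
      \<and> (\<forall>i. mono_mor C i \<and> Cod C i = s \<longrightarrow> zero_object C (Dom C i) \<or> iso_mor C i)"

text \<open>
  An object has finite length if it has a finite filtration with simple quotients: each
  application of the second rule adds one step \<open>0 \<rightarrow> Dom i \<rightarrow> Cod i \<rightarrow> Cod p \<rightarrow> 0\<close>.
\<close>

inductive finite_length :: "('k, 'o, 'm) tensor_category_data \<Rightarrow> 'o \<Rightarrow> bool"
  for C :: "('k, 'o, 'm) tensor_category_data" where
  finite_length_zero: "zero_object C x \<Longrightarrow> finite_length C x"
| finite_length_step: "\<lbrakk>finite_length C (Dom C i); is_kernel C p i; is_cokernel C i p;
      simple_object C (Cod C p)\<rbrakk> \<Longrightarrow> finite_length C (Cod C i)"

locale locally_finite_category = abelian_linear_category +
  assumes hom_finite_dimensional: "\<exists>S. finite S \<and> S \<subseteq> hom C a b \<and> hom C a b \<subseteq> hom_span C a b S"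
    and objects_finite_length: "finite_length C x"


subsection \<open>Monoidal structure, duals and braiding\<close>

locale monoidal_category = category +
  assumes tensor_hom: "\<lbrakk>f \<in> hom C a b; g \<in> hom C c d\<rbrakk> \<Longrightarrow> f \<otimes> g \<in> hom C (a \<odot> c) (b \<odot> d)"
    and tensor_ident: "ident C a \<otimes> ident C b = ident C (a \<odot> b)"
    and tensor_comp: "\<lbrakk>g \<in> hom C b c; f \<in> hom C a b; g' \<in> hom C b' c'; f' \<in> hom C a' b'\<rbrakk>
          \<Longrightarrow> (g \<cdot> f) \<otimes> (g' \<cdot> f') = (g \<otimes> g') \<cdot> (f \<otimes> f')"
    and assoc_hom: "assoc C a b c \<in> hom C ((a \<odot> b) \<odot> c) (a \<odot> (b \<odot> c))"
    and assoc_iso: "iso_mor C (assoc C a b c)"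
    and assoc_natural: "\<lbrakk>f \<in> hom C a a'; g \<in> hom C b b'; h \<in> hom C c c'\<rbrakk>
          \<Longrightarrow> assoc C a' b' c' \<cdot> ((f \<otimes> g) \<otimes> h) = (f \<otimes> (g \<otimes> h)) \<cdot> assoc C a b c"
    and lunit_hom: "lunit C a \<in> hom C (\<one> \<odot> a) a"
    and lunit_iso: "iso_mor C (lunit C a)"
    and lunit_natural: "f \<in> hom C a b \<Longrightarrow> lunit C b \<cdot> (ident C \<one> \<otimes> f) = f \<cdot> lunit C a"
    and runit_hom: "runit C a \<in> hom C (a \<odot> \<one>) a"
    and runit_iso: "iso_mor C (runit C a)"
    and runit_natural: "f \<in> hom C a b \<Longrightarrow> runit C b \<cdot> (f \<otimes> ident C \<one>) = f \<cdot> runit C a"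
    and pentagon: "assoc C a b (c \<odot> d) \<cdot> assoc C (a \<odot> b) c d
          = (ident C a \<otimes> assoc C b c d) \<cdot> assoc C a (b \<odot> c) d \<cdot> (assoc C a b c \<otimes> ident C d)"
    and triangle: "(ident C a \<otimes> lunit C b) \<cdot> assoc C a \<one> b = runit C a \<otimes> ident C b"

text \<open>
  \<open>is_left_dual C x y\<close>: the object \<open>y\<close> is a left dual \<open>x\<^sup>*\<close> of \<open>x\<close>, with evaluation
  \<open>x\<^sup>* \<otimes> x \<rightarrow> \<one>\<close> and coevaluation \<open>\<one> \<rightarrow> x \<otimes> x\<^sup>*\<close>; equivalently \<open>x\<close> is a right dual of \<open>y\<close>.
  The zigzag identities are composed with the unit isomorphisms of \<open>x\<close> and \<open>y\<close>.
\<close>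

definition is_left_dual :: "('k, 'o, 'm) tensor_category_data \<Rightarrow> 'o \<Rightarrow> 'o \<Rightarrow> bool" where
  "is_left_dual C x y \<longleftrightarrow>
    (\<exists>ev \<in> hom C (y \<odot>\<^bsub>C\<^esub> x) \<one>\<^bsub>C\<^esub>. \<exists>coev \<in> hom C \<one>\<^bsub>C\<^esub> (x \<odot>\<^bsub>C\<^esub> y).
       runit C x \<cdot>\<^bsub>C\<^esub> (ident C x \<otimes>\<^bsub>C\<^esub> ev) \<cdot>\<^bsub>C\<^esub> assoc C x y x \<cdot>\<^bsub>C\<^esub> (coev \<otimes>\<^bsub>C\<^esub> ident C x)
         = lunit C x \<and>
       lunit C y \<cdot>\<^bsub>C\<^esub> (ev \<otimes>\<^bsub>C\<^esub> ident C y) \<cdot>\<^bsub>C\<^esub> inv_mor C (assoc C y x y) \<cdot>\<^bsub>C\<^esub> (ident C y \<otimes>\<^bsub>C\<^esub> coev)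
         = runit C y)"

locale rigid_monoidal_category = monoidal_category +
  assumes left_dual_exists: "\<exists>y. is_left_dual C x y"
    and right_dual_exists: "\<exists>y. is_left_dual C y x"

locale symmetric_monoidal_category = monoidal_category +
  assumes braid_hom: "braid C a b \<in> hom C (a \<odot> b) (b \<odot> a)"
    and braid_natural: "\<lbrakk>f \<in> hom C a a'; g \<in> hom C b b'\<rbrakk>
          \<Longrightarrow> braid C a' b' \<cdot> (f \<otimes> g) = (g \<otimes> f) \<cdot> braid C a b"
    and braid_symmetric: "braid C b a \<cdot> braid C a b = ident C (a \<odot> b)"
    \<comment> \<open>the other hexagon follows from this one and symmetry\<close>
    and hexagon: "assoc C b c a \<cdot> braid C a (b \<odot> c) \<cdot> assoc C a b c
          = (ident C b \<otimes> braid C a c) \<cdot> assoc C b a c \<cdot> (braid C a b \<otimes> ident C c)"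

locale symmetric_tensor_category =
  locally_finite_category + rigid_monoidal_category + symmetric_monoidal_category +
  assumes tensor_add_left: "\<lbrakk>f \<in> hom C a b; g \<in> hom C a b; h \<in> hom C c d\<rbrakk>
          \<Longrightarrow> (f \<oplus> g) \<otimes> h = (f \<otimes> h) \<oplus> (g \<otimes> h)"
    and tensor_add_right: "\<lbrakk>h \<in> hom C c d; f \<in> hom C a b; g \<in> hom C a b\<rbrakk>
          \<Longrightarrow> h \<otimes> (f \<oplus> g) = (h \<otimes> f) \<oplus> (h \<otimes> g)"
    and tensor_scale_left: "\<lbrakk>f \<in> hom C a b; g \<in> hom C c d\<rbrakk> \<Longrightarrow> (r \<star> f) \<otimes> g = r \<star> (f \<otimes> g)"
    and tensor_scale_right: "\<lbrakk>f \<in> hom C a b; g \<in> hom C c d\<rbrakk> \<Longrightarrow> f \<otimes> (r \<star> g) = r \<star> (f \<otimes> g)"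
    and End_unit: "bij_betw (\<lambda>r. r \<star> ident C \<one>) UNIV (hom C \<one> \<one>)"


subsection \<open>Divided and symmetric squares, quadratic forms, algebras\<close>

text \<open>
  The pairs \<open>(\<Gamma>\<^sup>2(U), \<iota>\<^sub>U)\<close> and \<open>(S\<^sup>2(U), \<pi>\<^sub>U)\<close> are determined up to isomorphism only. They are
  given by the morphism, the object being its domain and codomain, respectively.
\<close>

definition is_Gamma2 :: "('k::field, 'o, 'm) tensor_category_data \<Rightarrow> 'o \<Rightarrow> 'm \<Rightarrow> bool" where
  "is_Gamma2 C U \<iota> \<longleftrightarrow> is_kernel C (ident C (U \<odot>\<^bsub>C\<^esub> U) \<ominus>\<^bsub>C\<^esub> braid C U U) \<iota>"

definition is_S2 :: "('k::field, 'o, 'm) tensor_category_data \<Rightarrow> 'o \<Rightarrow> 'm \<Rightarrow> bool" where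
  "is_S2 C U \<pi> \<longleftrightarrow> is_cokernel C (ident C (U \<odot>\<^bsub>C\<^esub> U) \<ominus>\<^bsub>C\<^esub> braid C U U) \<pi>"

definition is_Frobenius_twist :: "('k::field, 'o, 'm) tensor_category_data \<Rightarrow> 'o \<Rightarrow> 'o \<Rightarrow> bool" where
  "is_Frobenius_twist C U T \<longleftrightarrow>
    (\<exists>\<iota> \<pi> j. is_Gamma2 C U \<iota> \<and> is_S2 C U \<pi> \<and> is_image C (\<pi> \<cdot>\<^bsub>C\<^esub> \<iota>) j \<and> Dom C j = T)"

definition rho :: "('k, 'o, 'm) tensor_category_data \<Rightarrow> 'o \<Rightarrow> 'm \<Rightarrow> 'm" where
  "rho C U \<iota> = (THE r. r \<in> hom C (U \<odot>\<^bsub>C\<^esub> U) (Dom C \<iota>)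
      \<and> \<iota> \<cdot>\<^bsub>C\<^esub> r = ident C (U \<odot>\<^bsub>C\<^esub> U) \<oplus>\<^bsub>C\<^esub> braid C U U)"

definition is_quadratic_form :: "('k, 'o, 'm) tensor_category_data \<Rightarrow> 'm \<Rightarrow> 'm \<Rightarrow> bool" where
  "is_quadratic_form C \<iota> Q \<longleftrightarrow> Q \<in> hom C (Dom C \<iota>) \<one>\<^bsub>C\<^esub>"

definition bilinear_form :: "('k, 'o, 'm) tensor_category_data \<Rightarrow> 'o \<Rightarrow> 'm \<Rightarrow> 'm \<Rightarrow> 'm" where
  "bilinear_form C U \<iota> Q = Q \<cdot>\<^bsub>C\<^esub> rho C U \<iota>"

definition is_algebra :: "('k, 'o, 'm) tensor_category_data \<Rightarrow> 'o \<Rightarrow> 'm \<Rightarrow> bool" where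
  "is_algebra C U \<mu> \<longleftrightarrow> \<mu> \<in> hom C (U \<odot>\<^bsub>C\<^esub> U) U"

text \<open>
  \<open>id\<^sub>U \<otimes> c\<^bsub>U,U\<^esub> \<otimes> id\<^sub>U\<close> as an endomorphism of \<open>(U \<otimes> U) \<otimes> (U \<otimes> U)\<close>, with the associators
  written out.
\<close>

definition middle_braid :: "('k, 'o, 'm) tensor_category_data \<Rightarrow> 'o \<Rightarrow> 'm" where
  "middle_braid C U =
     inv_mor C (assoc C U U (U \<odot>\<^bsub>C\<^esub> U)) \<cdot>\<^bsub>C\<^esub>
     (ident C U \<otimes>\<^bsub>C\<^esub>
        (assoc C U U U \<cdot>\<^bsub>C\<^esub> (braid C U U \<otimes>\<^bsub>C\<^esub> ident C U) \<cdot>\<^bsub>C\<^esub> inv_mor C (assoc C U U U))) \<cdot>\<^bsub>C\<^esub>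
     assoc C U U (U \<odot>\<^bsub>C\<^esub> U)"

definition mu_hat :: "('k, 'o, 'm) tensor_category_data \<Rightarrow> 'o \<Rightarrow> 'm \<Rightarrow> 'm" where
  "mu_hat C U \<mu> = (\<mu> \<otimes>\<^bsub>C\<^esub> \<mu>) \<cdot>\<^bsub>C\<^esub> middle_braid C U"

definition mu_tilde :: "('k, 'o, 'm) tensor_category_data \<Rightarrow> 'o \<Rightarrow> 'm \<Rightarrow> 'm \<Rightarrow> 'm" where
  "mu_tilde C U \<mu> \<iota> = (THE m. m \<in> hom C (Dom C \<iota> \<odot>\<^bsub>C\<^esub> Dom C \<iota>) (Dom C \<iota>)
      \<and> \<iota> \<cdot>\<^bsub>C\<^esub> m = mu_hat C U \<mu> \<cdot>\<^bsub>C\<^esub> (\<iota> \<otimes>\<^bsub>C\<^esub> \<iota>))"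

text \<open>The tensor product of two forms \<open>x \<rightarrow> \<one>\<close> and \<open>y \<rightarrow> \<one>\<close>, followed by \<open>\<one> \<otimes> \<one> \<cong> \<one>\<close>.\<close>

definition tensor_form :: "('k, 'o, 'm) tensor_category_data \<Rightarrow> 'm \<Rightarrow> 'm \<Rightarrow> 'm" where
  "tensor_form C f g = lunit C \<one>\<^bsub>C\<^esub> \<cdot>\<^bsub>C\<^esub> (f \<otimes>\<^bsub>C\<^esub> g)"

end

(*
  Since \<iota> is monic and the braiding is natural for the interchange morphism of U (pentagon and
  hexagon), \<rho> \<cdot> \<mu>-hat \<cdot> ((id + c) \<otimes> id) = \<mu>-tilde \<cdot> (\<rho> \<otimes> \<rho>). So the linearized identity is the claimed
  identity precomposed with \<rho> \<otimes> \<rho>, and it remains to see that \<rho> \<otimes> \<rho> is epi. Rigidity makes tensor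
  products preserve epis. The morphism \<rho> itself is epi because \<rho> \<cdot> \<iota> = 2 is invertible when
  2 \<noteq> 0, and in characteristic 2 because \<Gamma>2(U) is the image of id + c when the Frobenius
  twist vanishes.
*)
theory Submission
  imports Defs
begin

section \<open>Composition and isomorphisms\<close>

context category
begin

lemma Dom_ident [simp]: "Dom C (ident C a) = a"
  and Cod_ident [simp]: "Cod C (ident C a) = a"
  using ident_hom[of a] by (auto simp: hom_def)

lemma Dom_comp [simp]: "Cod C f = Dom C g \<Longrightarrow> Dom C (g \<cdot> f) = Dom C f"
  and Cod_comp [simp]: "Cod C f = Dom C g \<Longrightarrow> Cod C (g \<cdot> f) = Cod C g"
  using comp_hom[of g "Dom C g" "Cod C g" f "Dom C f"] by (auto simp: hom_def)

lemma comp_assoc_eq [simp]: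
  "\<lbrakk>Cod C f = Dom C g; Cod C g = Dom C h\<rbrakk> \<Longrightarrow> (h \<cdot> g) \<cdot> f = h \<cdot> (g \<cdot> f)"
  using comp_assoc[of h "Dom C h" "Cod C h" g "Dom C g" f "Dom C f"] by (auto simp: hom_def)

lemma comp_ident_left [simp]: "Cod C f = a \<Longrightarrow> ident C a \<cdot> f = f"
  using ident_left[of f "Dom C f" a] by (auto simp: hom_def)

lemma comp_ident_right [simp]: "Dom C f = a \<Longrightarrow> f \<cdot> ident C a = f"
  using ident_right[of f a "Cod C f"] by (auto simp: hom_def)

text \<open>Composites are normalised to right-nested form, where the left side of an equation
  \<open>g \<cdot> f = k\<close> stops being a subterm as soon as \<open>f\<close> is precomposed
  with some \<open>h\<close>. This variant applies such an equation inside a longer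
  composite.\<close>

lemma comp_rewrite:
  assumes "g \<cdot> f = k" "Cod C f = Dom C g" "Cod C h = Dom C f"
  shows "g \<cdot> (f \<cdot> h) = k \<cdot> h"
  using assms by auto

text \<open>Makes the definite description in \<open>inv_mor\<close> meaningful, and later
  identifies two composites that invert the same morphism.\<close>

lemma inverse_mors_unique:
  assumes "inverse_mors C f g" "inverse_mors C f h"
  shows "g = h"
proof -
  have "g = g \<cdot> (f \<cdot> h)"
    using assms by (simp add: inverse_mors_def)
  also have "\<dots> = (g \<cdot> f) \<cdot> h"
    using assms by (intro comp_assoc_eq[symmetric]) (auto simp: inverse_mors_def)
  also have "\<dots> = h"
    using assms by (simp add: inverse_mors_def)
  finally show ?thesis .
qed

lemma inverse_mors_inv_mor: "iso_mor C f \<Longrightarrow> inverse_mors C f (inv_mor C f)"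
  unfolding inv_mor_def iso_mor_def by (metis theI inverse_mors_unique)

lemma Dom_inv_mor [simp]: "iso_mor C f \<Longrightarrow> Dom C (inv_mor C f) = Cod C f"
  and Cod_inv_mor [simp]: "iso_mor C f \<Longrightarrow> Cod C (inv_mor C f) = Dom C f"
  and inv_mor_comp [simp]: "iso_mor C f \<Longrightarrow> inv_mor C f \<cdot> f = ident C (Dom C f)"
  and comp_inv_mor [simp]: "iso_mor C f \<Longrightarrow> f \<cdot> inv_mor C f = ident C (Cod C f)"
  using inverse_mors_inv_mor[of f] by (auto simp: inverse_mors_def)

lemma inv_mor_comp_comp [simp]:
  "\<lbrakk>iso_mor C f; Cod C g = Dom C f\<rbrakk> \<Longrightarrow> inv_mor C f \<cdot> (f \<cdot> g) = g"
  by (simp add: comp_rewrite[OF inv_mor_comp])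

lemma comp_inv_mor_comp [simp]:
  "\<lbrakk>iso_mor C f; Cod C g = Cod C f\<rbrakk> \<Longrightarrow> f \<cdot> (inv_mor C f \<cdot> g) = g"
  by (simp add: comp_rewrite[OF comp_inv_mor])

lemma iso_mor_inv_mor: "iso_mor C f \<Longrightarrow> iso_mor C (inv_mor C f)"
  unfolding iso_mor_def[of C "inv_mor C f"] inverse_mors_def by (intro exI[of _ f]) auto

lemma iso_mor_comp:
  assumes "iso_mor C f" "iso_mor C g" "Cod C f = Dom C g"
  shows "iso_mor C (g \<cdot> f)"
  unfolding iso_mor_def inverse_mors_def
  using assms by (intro exI[of _ "inv_mor C f \<cdot> inv_mor C g"]) auto

lemma comp_eq_iff_inv_mor_left:
  assumes "iso_mor C f" "Cod C g = Dom C f" "Cod C h = Cod C f"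
  shows "f \<cdot> g = h \<longleftrightarrow> g = inv_mor C f \<cdot> h"
  using assms by (metis comp_inv_mor_comp inv_mor_comp_comp)

lemma comp_eq_iff_inv_mor_right:
  assumes "iso_mor C f" "Dom C g = Cod C f" "Dom C h = Dom C f"
  shows "g \<cdot> f = h \<longleftrightarrow> g = h \<cdot> inv_mor C f"
  using assms by auto

lemma epi_morD:
  "\<lbrakk>epi_mor C e; g \<cdot> e = h \<cdot> e; Dom C g = Cod C e; Dom C h = Cod C e; Cod C g = Cod C h\<rbrakk> \<Longrightarrow> g = h"
  unfolding epi_mor_def by blast

lemma iso_mor_epi: "iso_mor C f \<Longrightarrow> epi_mor C f"
  unfolding epi_mor_def by (metis comp_eq_iff_inv_mor_right Dom_comp)

lemma mono_morD:
  "\<lbrakk>mono_mor C f; f \<cdot> g = f \<cdot> h; Cod C g = Dom C f; Cod C h = Dom C f; Dom C g = Dom C h\<rbrakk> \<Longrightarrow> g = h"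
  unfolding mono_mor_def by blast

lemma mono_mor_comp:
  assumes "mono_mor C f" "mono_mor C g" "Cod C f = Dom C g"
  shows "mono_mor C (g \<cdot> f)"
  unfolding mono_mor_def
proof (intro allI impI, elim conjE)
  fix u v assume uv: "Dom C u = Dom C v" "Cod C u = Dom C (g \<cdot> f)" "Cod C v = Dom C (g \<cdot> f)"
    "(g \<cdot> f) \<cdot> u = (g \<cdot> f) \<cdot> v"
  have "f \<cdot> u = f \<cdot> v"
    by (rule mono_morD[OF assms(2)]) (use uv assms(3) in auto)
  then show "u = v"
    by (rule mono_morD[OF assms(1)]) (use uv assms(3) in auto)
qed

lemma epi_mor_comp:
  assumes "epi_mor C f" "epi_mor C g" "Cod C f = Dom C g"
  shows "epi_mor C (g \<cdot> f)"
  unfolding epi_mor_def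
proof (intro allI impI, elim conjE)
  fix u v assume uv: "Cod C u = Cod C v" "Dom C u = Cod C (g \<cdot> f)" "Dom C v = Cod C (g \<cdot> f)"
    "u \<cdot> g \<cdot> f = v \<cdot> g \<cdot> f"
  have "u \<cdot> g = v \<cdot> g"
    by (rule epi_morD[OF assms(1)]) (use uv assms(3) in auto)
  then show "u = v"
    by (rule epi_morD[OF assms(2)]) (use uv assms(3) in auto)
qed

end


section \<open>Linear categories\<close>

context linear_category
begin

lemma Dom_zero_mor [simp]: "Dom C (zero_mor C a b) = a"
  and Cod_zero_mor [simp]: "Cod C (zero_mor C a b) = b"
  using zero_hom[of a b] by (auto simp: hom_def)

lemma Dom_scale [simp]: "Dom C (r \<star> f) = Dom C f"
  and Cod_scale [simp]: "Cod C (r \<star> f) = Cod C f"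
  using scale_hom[of f "Dom C f" "Cod C f" r] by (auto simp: hom_def)

lemma Dom_add [simp]: "\<lbrakk>Dom C g = Dom C f; Cod C g = Cod C f\<rbrakk> \<Longrightarrow> Dom C (f \<oplus> g) = Dom C f"
  and Cod_add [simp]: "\<lbrakk>Dom C g = Dom C f; Cod C g = Cod C f\<rbrakk> \<Longrightarrow> Cod C (f \<oplus> g) = Cod C f"
  using add_hom[of f "Dom C f" "Cod C f" g] by (auto simp: hom_def)

text \<open>The axioms only say that zero is neutral and that negatives exist, so the vanishing of
  \<open>0 \<star> f\<close> and of composites with zero is read off from an equation of this
  kind.\<close>

lemma add_eq_self_imp_zero:
  assumes "f \<in> hom C a b" "f \<oplus> f = f"
  shows "f = zero_mor C a b"
proof -
  obtain g where g: "g \<in> hom C a b" "f \<oplus> g = zero_mor C a b"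
    using neg_exists assms by blast
  have "f = zero_mor C a b \<oplus> f"
    using zero_left assms by simp
  also have "\<dots> = f \<oplus> (f \<oplus> g)"
    using g add_comm[OF zero_hom assms(1)] by simp
  also have "\<dots> = (f \<oplus> f) \<oplus> g"
    by (rule add_assoc[OF assms(1) assms(1) g(1), symmetric])
  finally show ?thesis using assms g by simp
qed

lemma scale_zero_left: "f \<in> hom C a b \<Longrightarrow> 0 \<star> f = zero_mor C a b"
  using scale_add_left[of f a b 0 0] scale_hom by (intro add_eq_self_imp_zero) auto

lemma comp_zero_right: "Dom C g = b \<Longrightarrow> g \<cdot> zero_mor C a b = zero_mor C a (Cod C g)"
  using comp_add_right[of g b "Cod C g" "zero_mor C a b" a "zero_mor C a b"] zero_left zero_hom
    comp_hom[of g b "Cod C g" "zero_mor C a b" a]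
  by (intro add_eq_self_imp_zero) (auto simp: hom_def)

lemma comp_zero_left: "Cod C f = b \<Longrightarrow> zero_mor C b c \<cdot> f = zero_mor C (Dom C f) c"
  using comp_add_left[of "zero_mor C b c" b c "zero_mor C b c" f "Dom C f"] zero_left zero_hom
    comp_hom[of "zero_mor C b c" b c f "Dom C f"]
  by (intro add_eq_self_imp_zero) (auto simp: hom_def)

text \<open>The scalar \<open>- 1\<close> acts as negation because \<open>- 1 + 1 = 0\<close>. The
  equivalence later turns vanishing of composites with \<open>id - c\<close> into invariance under
  \<open>c\<close>.\<close>

lemma diff_eq_zero_iff:
  assumes "f \<in> hom C a b" "g \<in> hom C a b"
  shows "f \<ominus> g = zero_mor C a b \<longleftrightarrow> f = g"
proof
  have neg: "((- 1) \<star> h) \<oplus> h = zero_mor C a b" if "h \<in> hom C a b" for h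
    using scale_add_left[OF that, of "- 1" 1] scale_zero_left[OF that] scale_one[OF that] by simp
  show "f \<ominus> g = zero_mor C a b" if "f = g"
    using neg[of g] assms that scale_hom add_comm by (metis diff_mor_def)
  assume *: "f \<ominus> g = zero_mor C a b"
  have "f = zero_mor C a b \<oplus> f"
    using zero_left assms by simp
  also have "\<dots> = f \<oplus> (((- 1) \<star> g) \<oplus> g)"
    using neg[OF assms(2)] add_comm[OF zero_hom assms(1)] by simp
  also have "\<dots> = (f \<ominus> g) \<oplus> g"
    using assms add_assoc scale_hom by (simp add: diff_mor_def)
  also have "\<dots> = g"
    using * zero_left assms by simp
  finally show "f = g" .
qed

lemma comp_diff_right:
  "\<lbrakk>g \<in> hom C b c; f \<in> hom C a b; h \<in> hom C a b\<rbrakk> \<Longrightarrow> g \<cdot> (f \<ominus> h) = (g \<cdot> f) \<ominus> (g \<cdot> h)"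
  using comp_add_right[of g b c f a "(- 1) \<star> h"] comp_scale_right scale_hom
  by (simp add: diff_mor_def)

lemma comp_diff_left:
  "\<lbrakk>g \<in> hom C b c; h \<in> hom C b c; f \<in> hom C a b\<rbrakk> \<Longrightarrow> (g \<ominus> h) \<cdot> f = (g \<cdot> f) \<ominus> (h \<cdot> f)"
  using comp_add_left[of g b c "(- 1) \<star> h" f a] comp_scale_left scale_hom
  by (simp add: diff_mor_def)

text \<open>By additivity, two morphisms that agree after precomposition with \<open>f\<close>
  differ by one that precomposition with \<open>f\<close> kills.\<close>

lemma epi_morI:
  assumes "\<And>t. \<lbrakk>Dom C t = Cod C f; t \<cdot> f = zero_mor C (Dom C f) (Cod C t)\<rbrakk>
    \<Longrightarrow> t = zero_mor C (Cod C f) (Cod C t)"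
  shows "epi_mor C f"
  unfolding epi_mor_def
proof (intro allI impI, elim conjE)
  fix g h assume gh: "Cod C g = Cod C h" "Dom C g = Cod C f" "Dom C h = Cod C f" "g \<cdot> f = h \<cdot> f"
  have homs: "f \<in> hom C (Dom C f) (Cod C f)" "g \<in> hom C (Cod C f) (Cod C h)"
    "h \<in> hom C (Cod C f) (Cod C h)"
    using gh by (auto simp: hom_def)
  have D: "Dom C (g \<ominus> h) = Cod C f" "Cod C (g \<ominus> h) = Cod C h"
    using gh by (auto simp: diff_mor_def)
  have "(g \<ominus> h) \<cdot> f = zero_mor C (Dom C f) (Cod C h)"
    using comp_diff_left[OF homs(2,3,1)] gh diff_eq_zero_iff comp_hom[OF homs(3,1)] by simp
  then have "g \<ominus> h = zero_mor C (Cod C f) (Cod C h)"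
    using assms[of "g \<ominus> h"] D by simp
  then show "g = h"
    using diff_eq_zero_iff[OF homs(2,3)] by simp
qed

section \<open>Kernels and images\<close>

lemma is_kernel_factor:
  assumes "is_kernel C f k" "Cod C g = Dom C f" "f \<cdot> g = zero_mor C (Dom C g) (Cod C f)"
  obtains h where "Dom C h = Dom C g" "Cod C h = Dom C k" "k \<cdot> h = g"
proof -
  have "\<exists>h. h \<in> hom C (Dom C g) (Dom C k) \<and> k \<cdot> h = g"
    using assms unfolding is_kernel_def by metis
  then show ?thesis
    using that by (auto simp: hom_def)
qed

text \<open>Both \<open>g\<close> and \<open>h\<close> factor the morphism
  \<open>k \<cdot> h\<close> through \<open>k\<close>, and the universal property admits only one
  such factorisation.\<close>

lemma is_kernel_mono: "is_kernel C f k \<Longrightarrow> mono_mor C k"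
  unfolding mono_mor_def
proof (intro allI impI, elim conjE)
  fix g h assume k: "is_kernel C f k" and gh: "Dom C g = Dom C h" "Cod C g = Dom C k"
    "Cod C h = Dom C k" "k \<cdot> g = k \<cdot> h"
  have "f \<cdot> (k \<cdot> h) = (f \<cdot> k) \<cdot> h"
    using k gh by (intro comp_assoc_eq[symmetric]) (auto simp: is_kernel_def)
  then have "f \<cdot> (k \<cdot> h) = zero_mor C (Dom C h) (Cod C f)"
    using k gh comp_zero_left by (simp add: is_kernel_def)
  then have "\<exists>!u. u \<in> hom C (Dom C h) (Dom C k) \<and> k \<cdot> u = k \<cdot> h"
    using k gh unfolding is_kernel_def by (metis Cod_comp Dom_comp)
  then show "g = h"
    using gh by (auto simp: hom_def)
qed

text \<open>The cokernel of \<open>f\<close> kills \<open>f\<close>, so \<open>f\<close> factors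
  through the kernel \<open>j\<close> of that cokernel, here through a zero object.\<close>

lemma zero_mor_if_zero_object_image:
  assumes "is_image C f j" "zero_object C (Dom C j)"
  shows "f = zero_mor C (Dom C f) (Cod C f)"
proof -
  obtain q where q: "is_cokernel C f q" "is_kernel C q j"
    using assms by (auto simp: is_image_def)
  obtain h where h: "h \<in> hom C (Dom C f) (Dom C j)" "j \<cdot> h = f"
    using q unfolding is_cokernel_def is_kernel_def by metis
  have "h = zero_mor C (Dom C f) (Dom C j)"
    using assms(2) h zero_hom unfolding zero_object_def by blast
  then show ?thesis
    using h(2) comp_zero_right[of j "Dom C j" "Dom C f"] q
    by (metis is_cokernel_def is_kernel_def)
qed

end


section \<open>Coherence in monoidal categories\<close>

context monoidal_category
begin

lemma Dom_tensor [simp]: "Dom C (f \<otimes> g) = Dom C f \<odot> Dom C g"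
  and Cod_tensor [simp]: "Cod C (f \<otimes> g) = Cod C f \<odot> Cod C g"
  using tensor_hom[of f "Dom C f" "Cod C f" g "Dom C g" "Cod C g"] by (auto simp: hom_def)

lemma Dom_assoc [simp]: "Dom C (assoc C a b c) = (a \<odot> b) \<odot> c"
  and Cod_assoc [simp]: "Cod C (assoc C a b c) = a \<odot> (b \<odot> c)"
  using assoc_hom[of a b c] by (auto simp: hom_def)

lemma Dom_lunit [simp]: "Dom C (lunit C a) = \<one> \<odot> a"
  and Cod_lunit [simp]: "Cod C (lunit C a) = a"
  using lunit_hom[of a] by (auto simp: hom_def)

lemma Dom_runit [simp]: "Dom C (runit C a) = a \<odot> \<one>"
  and Cod_runit [simp]: "Cod C (runit C a) = a"
  using runit_hom[of a] by (auto simp: hom_def)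

lemmas [simp] = tensor_ident assoc_iso lunit_iso runit_iso

lemma tensor_comp_tensor:
  "\<lbrakk>Cod C f = Dom C g; Cod C f' = Dom C g'\<rbrakk> \<Longrightarrow> (g \<otimes> g') \<cdot> (f \<otimes> f') = (g \<cdot> f) \<otimes> (g' \<cdot> f')"
  using tensor_comp[of g "Dom C g" "Cod C g" f "Dom C f" g' "Dom C g'" "Cod C g'" f' "Dom C f'"]
  by (auto simp: hom_def)

lemma tensor_comp_tensor_comp:
  "\<lbrakk>Cod C f = Dom C g; Cod C f' = Dom C g'; Cod C h = Dom C f \<odot> Dom C f'\<rbrakk>
    \<Longrightarrow> (g \<otimes> g') \<cdot> ((f \<otimes> f') \<cdot> h) = ((g \<cdot> f) \<otimes> (g' \<cdot> f')) \<cdot> h"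
  by (rule comp_rewrite[OF tensor_comp_tensor]) auto

lemma assoc_comp_tensor:
  "assoc C (Cod C f) (Cod C g) (Cod C h) \<cdot> ((f \<otimes> g) \<otimes> h)
    = (f \<otimes> (g \<otimes> h)) \<cdot> assoc C (Dom C f) (Dom C g) (Dom C h)"
  using assoc_natural by (auto simp: hom_def)

lemma tensor_comp_inv_assoc:
  "((f \<otimes> g) \<otimes> h) \<cdot> inv_mor C (assoc C (Dom C f) (Dom C g) (Dom C h))
    = inv_mor C (assoc C (Cod C f) (Cod C g) (Cod C h)) \<cdot> (f \<otimes> (g \<otimes> h))"
  using assoc_comp_tensor[of f g h]
  by (simp add: comp_eq_iff_inv_mor_left flip: comp_eq_iff_inv_mor_right)

lemma lunit_comp_tensor: "lunit C (Cod C f) \<cdot> (ident C \<one> \<otimes> f) = f \<cdot> lunit C (Dom C f)"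
  using lunit_natural by (auto simp: hom_def)

lemma iso_mor_ident: "iso_mor C (ident C a)"
  unfolding iso_mor_def inverse_mors_def by (intro exI[of _ "ident C a"]) auto

lemma iso_mor_tensor:
  assumes "iso_mor C f" "iso_mor C g"
  shows "iso_mor C (f \<otimes> g)"
  unfolding iso_mor_def inverse_mors_def
  using assms
  by (intro exI[of _ "inv_mor C f \<otimes> inv_mor C g"]) (auto simp: tensor_comp_tensor)

text \<open>The pentagon with every side except \<open>ident C a \<otimes> assoc C b c d\<close>
  inverted. It serves both the zigzag computation and the rebracketing of the interchange.\<close>

lemma pentagon_inv_left:
  "inv_mor C (assoc C (a \<odot> b) c d) \<cdot> inv_mor C (assoc C a b (c \<odot> d)) \<cdot> (ident C a \<otimes> assoc C b c d)
    = (inv_mor C (assoc C a b c) \<otimes> ident C d) \<cdot> inv_mor C (assoc C a (b \<odot> c) d)"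
proof -
  have "(ident C a \<otimes> assoc C b c d)
      = assoc C a b (c \<odot> d) \<cdot> assoc C (a \<odot> b) c d \<cdot> (inv_mor C (assoc C a b c) \<otimes> ident C d)
          \<cdot> inv_mor C (assoc C a (b \<odot> c) d)"
    using arg_cong[OF pentagon[of a b c d], of "\<lambda>f. f \<cdot> (inv_mor C (assoc C a b c) \<otimes> ident C d)
          \<cdot> inv_mor C (assoc C a (b \<odot> c) d)"]
    by (simp add: tensor_comp_tensor_comp)
  then show ?thesis
    by simp
qed

lemma pentagon_inv_right:
  "inv_mor C (assoc C a (b \<odot> c) d) \<cdot> (ident C a \<otimes> inv_mor C (assoc C b c d)) \<cdot> assoc C a b (c \<odot> d)
    = (assoc C a b c \<otimes> ident C d) \<cdot> inv_mor C (assoc C (a \<odot> b) c d)"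
proof -
  have "assoc C a b (c \<odot> d) = (ident C a \<otimes> assoc C b c d) \<cdot> assoc C a (b \<odot> c) d
      \<cdot> (assoc C a b c \<otimes> ident C d) \<cdot> inv_mor C (assoc C (a \<odot> b) c d)"
    using arg_cong[OF pentagon[of a b c d], of "\<lambda>f. f \<cdot> inv_mor C (assoc C (a \<odot> b) c d)"]
    by simp
  then show ?thesis
    by (simp add: tensor_comp_tensor_comp)
qed

end


section \<open>Tensoring with an object preserves epimorphisms\<close>

context rigid_monoidal_category
begin

text \<open>
  A left adjoint preserves epis. Only injectivity of \<open>transpose\<close> is needed, so it suffices that
  \<open>transpose_inverse\<close> recovers \<open>f\<close> up to some isomorphism \<open>w\<close>; this avoids proving that \<open>w\<close> is the
  unit isomorphism.
\<close>

lemma epi_mor_ident_tensor: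
  assumes e: "epi_mor C e"
  shows "epi_mor C (ident C x \<otimes> e)"
proof -
  define A B where "A = Dom C e" and "B = Cod C e"
  note [simp] = A_def[symmetric] B_def[symmetric]
  obtain y ev coev where dual [simp]: "Dom C ev = x \<odot> y" "Cod C ev = \<one>"
      "Dom C coev = \<one>" "Cod C coev = y \<odot> x"
    and zigzag: "lunit C x \<cdot> (ev \<otimes> ident C x) \<cdot> inv_mor C (assoc C x y x) \<cdot> (ident C x \<otimes> coev)
        = runit C x"
    using right_dual_exists[of x] by (auto simp: is_left_dual_def hom_def)
  \<comment> \<open>With \<open>y\<close> a right dual of \<open>x\<close>, this is the adjunction
    map taking \<open>x \<odot> B \<rightarrow> Z\<close> to
    \<open>\<one> \<odot> B \<rightarrow> y \<odot> Z\<close>.\<close>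
  define transpose where
    "transpose f = (ident C y \<otimes> f) \<cdot> assoc C y x B \<cdot> (coev \<otimes> ident C B)" for f
  \<comment> \<open>The zigzag composite without its final unit isomorphism; the zigzag identity
    shows that it is built from unit isomorphisms, hence invertible.\<close>
  define z where "z = (ev \<otimes> ident C x) \<cdot> inv_mor C (assoc C x y x) \<cdot> (ident C x \<otimes> coev)"
  have [simp]: "Dom C z = x \<odot> \<one>" "Cod C z = \<one> \<odot> x"
    by (auto simp: z_def)
  have "z = inv_mor C (lunit C x) \<cdot> runit C x"
    using zigzag by (simp add: comp_eq_iff_inv_mor_left z_def)
  then have "iso_mor C z"
    by (simp add: iso_mor_comp iso_mor_inv_mor)
  \<comment> \<open>What remains when \<open>ev\<close> is applied to a transpose: the zigzag on
    \<open>x\<close>, tensored with \<open>B\<close> and rebracketed. Every factor is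
    invertible.\<close>
  define w where "w = lunit C (x \<odot> B) \<cdot> assoc C \<one> x B \<cdot> (z \<otimes> ident C B) \<cdot> inv_mor C (assoc C x \<one> B)"
  have [simp]: "Dom C w = x \<odot> (\<one> \<odot> B)" "Cod C w = x \<odot> B"
    by (auto simp: w_def)
  have "iso_mor C w"
    unfolding w_def using \<open>iso_mor C z\<close>
    by (intro iso_mor_comp iso_mor_tensor iso_mor_inv_mor iso_mor_ident) auto
  have transpose_inverse: "lunit C Z \<cdot> (ev \<otimes> ident C Z) \<cdot> inv_mor C (assoc C x y Z)
      \<cdot> (ident C x \<otimes> transpose f) = f \<cdot> w" if f: "Dom C f = x \<odot> B" "Cod C f = Z" for f Z
  proof -
    note [simp] = f
    \<comment> \<open>Naturality slides \<open>f\<close> to the left until it can pass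
      \<open>ev\<close>; the pentagon then rebrackets so that \<open>ev\<close> and
      \<open>coev\<close> act around \<open>x\<close> alone and meet in \<open>z\<close>.\<close>
    have "inv_mor C (assoc C x y Z) \<cdot> (ident C x \<otimes> transpose f)
        = inv_mor C (assoc C x y Z) \<cdot> (ident C x \<otimes> (ident C y \<otimes> f)) \<cdot> (ident C x \<otimes> assoc C y x B)
          \<cdot> (ident C x \<otimes> (coev \<otimes> ident C B))"
      by (simp add: transpose_def tensor_comp_tensor)
    also have "\<dots> = (ident C (x \<odot> y) \<otimes> f) \<cdot> inv_mor C (assoc C x y (x \<odot> B)) \<cdot> (ident C x \<otimes> assoc C y x B)
          \<cdot> (ident C x \<otimes> (coev \<otimes> ident C B))"
      using comp_rewrite[OF tensor_comp_inv_assoc[of "ident C x" "ident C y" f, symmetric],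
          of "(ident C x \<otimes> assoc C y x B) \<cdot> (ident C x \<otimes> (coev \<otimes> ident C B))"]
      by simp
    also have "inv_mor C (assoc C x y (x \<odot> B)) \<cdot> (ident C x \<otimes> assoc C y x B)
          \<cdot> (ident C x \<otimes> (coev \<otimes> ident C B))
        = assoc C (x \<odot> y) x B \<cdot> (inv_mor C (assoc C x y x) \<otimes> ident C B)
          \<cdot> inv_mor C (assoc C x (y \<odot> x) B) \<cdot> (ident C x \<otimes> (coev \<otimes> ident C B))"
      using arg_cong[OF pentagon_inv_left[of x y x B],
          of "\<lambda>f. assoc C (x \<odot> y) x B \<cdot> f \<cdot> (ident C x \<otimes> (coev \<otimes> ident C B))"]
      by simp
    also have "inv_mor C (assoc C x (y \<odot> x) B) \<cdot> (ident C x \<otimes> (coev \<otimes> ident C B))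
        = ((ident C x \<otimes> coev) \<otimes> ident C B) \<cdot> inv_mor C (assoc C x \<one> B)"
      using tensor_comp_inv_assoc[of "ident C x" coev "ident C B"] by simp
    finally have "(ev \<otimes> ident C Z) \<cdot> inv_mor C (assoc C x y Z) \<cdot> (ident C x \<otimes> transpose f)
      = (ident C \<one> \<otimes> f) \<cdot> (ev \<otimes> (ident C x \<otimes> ident C B)) \<cdot> assoc C (x \<odot> y) x B
          \<cdot> (inv_mor C (assoc C x y x) \<otimes> ident C B)
          \<cdot> ((ident C x \<otimes> coev) \<otimes> ident C B) \<cdot> inv_mor C (assoc C x \<one> B)"
      by (simp add: tensor_comp_tensor_comp)
    also have "(ev \<otimes> (ident C x \<otimes> ident C B)) \<cdot> assoc C (x \<odot> y) x B
          \<cdot> (inv_mor C (assoc C x y x) \<otimes> ident C B)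
          \<cdot> ((ident C x \<otimes> coev) \<otimes> ident C B) \<cdot> inv_mor C (assoc C x \<one> B)
        = assoc C \<one> x B \<cdot> ((ev \<otimes> ident C x) \<otimes> ident C B) \<cdot> (inv_mor C (assoc C x y x) \<otimes> ident C B)
          \<cdot> ((ident C x \<otimes> coev) \<otimes> ident C B) \<cdot> inv_mor C (assoc C x \<one> B)"
      using comp_rewrite[OF assoc_comp_tensor[of ev "ident C x" "ident C B", symmetric],
          of "(inv_mor C (assoc C x y x) \<otimes> ident C B)
          \<cdot> ((ident C x \<otimes> coev) \<otimes> ident C B) \<cdot> inv_mor C (assoc C x \<one> B)"]
      by simp
    also have "\<dots> = assoc C \<one> x B \<cdot> (z \<otimes> ident C B) \<cdot> inv_mor C (assoc C x \<one> B)"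
      by (simp add: z_def tensor_comp_tensor_comp)
    finally show ?thesis
      using comp_rewrite[OF lunit_comp_tensor[of f],
          of "assoc C \<one> x B \<cdot> (z \<otimes> ident C B) \<cdot> inv_mor C (assoc C x \<one> B)"]
      by (simp add: w_def)
  qed
  have transpose_natural: "transpose f \<cdot> (ident C \<one> \<otimes> e)
      = (ident C y \<otimes> (f \<cdot> (ident C x \<otimes> e))) \<cdot> assoc C y x A \<cdot> (coev \<otimes> ident C A)"
    if f: "Dom C f = x \<odot> B" for f
  proof -
    have "transpose f \<cdot> (ident C \<one> \<otimes> e)
        = (ident C y \<otimes> f) \<cdot> assoc C y x B \<cdot> ((ident C y \<otimes> ident C x) \<otimes> e) \<cdot> (coev \<otimes> ident C A)"
      using f by (simp add: transpose_def tensor_comp_tensor)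
    also have "\<dots> = (ident C y \<otimes> f) \<cdot> (ident C y \<otimes> (ident C x \<otimes> e)) \<cdot> assoc C y x A \<cdot> (coev \<otimes> ident C A)"
      using comp_rewrite[OF assoc_comp_tensor[of "ident C y" "ident C x" e], of "coev \<otimes> ident C A"]
      by simp
    finally show ?thesis
      using f by (simp add: tensor_comp_tensor_comp)
  qed
  \<comment> \<open>Tensoring with the unit changes \<open>e\<close> only by unit isomorphisms, so
    the result is still epi. Transposing reduces cancellation of
    \<open>ident C x \<otimes> e\<close> to cancellation of this morphism.\<close>
  have "ident C \<one> \<otimes> e = inv_mor C (lunit C B) \<cdot> e \<cdot> lunit C A"
    using lunit_comp_tensor[of e] by (simp add: comp_eq_iff_inv_mor_left)
  moreover have "epi_mor C (e \<cdot> lunit C A)"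
    by (rule epi_mor_comp[OF iso_mor_epi e]) auto
  then have "epi_mor C (inv_mor C (lunit C B) \<cdot> e \<cdot> lunit C A)"
    by (rule epi_mor_comp[OF _ iso_mor_epi[OF iso_mor_inv_mor]]) auto
  ultimately have epi: "epi_mor C (ident C \<one> \<otimes> e)"
    by simp
  show ?thesis
    unfolding epi_mor_def
  proof (intro allI impI, elim conjE)
    fix f g assume fg: "Cod C f = Cod C g" "Dom C f = Cod C (ident C x \<otimes> e)"
      "Dom C g = Cod C (ident C x \<otimes> e)" "f \<cdot> (ident C x \<otimes> e) = g \<cdot> (ident C x \<otimes> e)"
    have "transpose f = transpose g"
      by (rule epi_morD[OF epi]) (use fg in \<open>simp_all add: transpose_natural, simp_all add: transpose_def\<close>)
    then have "f \<cdot> w = g \<cdot> w"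
      using transpose_inverse[of f] transpose_inverse[of g] fg by simp
    then show "f = g"
      by (rule epi_morD[OF iso_mor_epi[OF \<open>iso_mor C w\<close>]]) (use fg in auto)
  qed
qed

end


section \<open>The braiding and the interchange morphism\<close>

text \<open>With four equal objects this is \<open>middle_braid\<close>. Distinct objects record
  which factor sits where, so that instances of naturality, hexagon and pentagon can be told
  apart.\<close>

definition interchange :: "('k, 'o, 'm) tensor_category_data \<Rightarrow> 'o \<Rightarrow> 'o \<Rightarrow> 'o \<Rightarrow> 'o \<Rightarrow> 'm" where
  "interchange C a b c d =
     inv_mor C (assoc C a c (b \<odot>\<^bsub>C\<^esub> d)) \<cdot>\<^bsub>C\<^esub>
     (ident C a \<otimes>\<^bsub>C\<^esub>
        (assoc C c b d \<cdot>\<^bsub>C\<^esub> (braid C b c \<otimes>\<^bsub>C\<^esub> ident C d) \<cdot>\<^bsub>C\<^esub> inv_mor C (assoc C b c d))) \<cdot>\<^bsub>C\<^esub>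
     assoc C a b (c \<odot>\<^bsub>C\<^esub> d)"

context symmetric_monoidal_category
begin

lemma Dom_braid [simp]: "Dom C (braid C a b) = a \<odot> b"
  and Cod_braid [simp]: "Cod C (braid C a b) = b \<odot> a"
  using braid_hom[of a b] by (auto simp: hom_def)

lemma braid_braid [simp]: "braid C b a \<cdot> braid C a b = ident C (a \<odot> b)"
  by (rule braid_symmetric)

lemma braid_braid_comp [simp]:
  "Cod C f = a \<odot> b \<Longrightarrow> braid C b a \<cdot> (braid C a b \<cdot> f) = f"
  by (simp add: comp_rewrite[OF braid_braid])

lemma braid_comp_tensor:
  "braid C (Cod C f) (Cod C g) \<cdot> (f \<otimes> g) = (g \<otimes> f) \<cdot> braid C (Dom C f) (Dom C g)"
  by (rule braid_natural) (auto simp: hom_def)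

lemma iso_mor_braid: "iso_mor C (braid C a b)"
  unfolding iso_mor_def inverse_mors_def by (intro exI[of _ "braid C b a"]) auto

text \<open>Both sides invert the same composite \<open>H\<close>: the left one because each
  braiding is undone by its reverse, the right one after the hexagon axiom has rewritten
  \<open>H\<close>. This is the second hexagon, for a product in the first slot of the
  braiding.\<close>

lemma hexagon_inv:
  "inv_mor C (assoc C b a c) \<cdot> braid C (a \<odot> c) b \<cdot> inv_mor C (assoc C a c b)
    = (braid C a b \<otimes> ident C c) \<cdot> inv_mor C (assoc C a b c) \<cdot> (ident C a \<otimes> braid C c b)"
proof -
  define L where "L = inv_mor C (assoc C b a c) \<cdot> braid C (a \<odot> c) b \<cdot> inv_mor C (assoc C a c b)"
  define R where
    "R = (braid C a b \<otimes> ident C c) \<cdot> inv_mor C (assoc C a b c) \<cdot> (ident C a \<otimes> braid C c b)"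
  define H where "H = assoc C a c b \<cdot> braid C b (a \<odot> c) \<cdot> assoc C b a c"
  have H: "H = (ident C a \<otimes> braid C b c) \<cdot> assoc C a b c \<cdot> (braid C b a \<otimes> ident C c)"
    unfolding H_def by (rule hexagon)
  have [simp]: "Dom C H = (b \<odot> a) \<odot> c" "Cod C H = a \<odot> (c \<odot> b)"
    "Dom C L = a \<odot> (c \<odot> b)" "Cod C L = (b \<odot> a) \<odot> c" "Dom C R = a \<odot> (c \<odot> b)" "Cod C R = (b \<odot> a) \<odot> c"
    by (simp_all add: H_def L_def R_def)
  have "R \<cdot> H = ident C ((b \<odot> a) \<odot> c)"
    by (simp add: R_def H tensor_comp_tensor_comp tensor_comp_tensor)
  moreover have "H \<cdot> R = ident C (a \<odot> (c \<odot> b))"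
    by (simp add: R_def H tensor_comp_tensor_comp tensor_comp_tensor)
  ultimately have "inverse_mors C H R"
    by (simp add: inverse_mors_def)
  moreover have "inverse_mors C H L"
    by (simp add: inverse_mors_def) (simp add: L_def H_def)
  ultimately have "L = R"
    by (metis inverse_mors_unique)
  then show ?thesis
    by (simp add: L_def R_def)
qed

lemma braid_comp_inv_assoc:
  "braid C (a \<odot> c) b \<cdot> inv_mor C (assoc C a c b)
    = assoc C b a c \<cdot> (braid C a b \<otimes> ident C c) \<cdot> inv_mor C (assoc C a b c) \<cdot> (ident C a \<otimes> braid C c b)"
  by (simp flip: hexagon_inv)


lemma Dom_interchange [simp]: "Dom C (interchange C a b c d) = (a \<odot> b) \<odot> (c \<odot> d)"
  and Cod_interchange [simp]: "Cod C (interchange C a b c d) = (a \<odot> c) \<odot> (b \<odot> d)"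
  by (simp_all add: interchange_def)

text \<open>Regroups \<open>a\<close>, \<open>b\<close>, \<open>c\<close> on the left with
  \<open>d\<close> as a passive factor, so that a braiding of \<open>a \<odot> c\<close> past
  \<open>b\<close> can be composed within the left factor.\<close>

lemma inv_assoc_comp_interchange:
  "inv_mor C (assoc C (a \<odot> c) b d) \<cdot> interchange C a b c d
    = ((inv_mor C (assoc C a c b) \<cdot> (ident C a \<otimes> braid C b c) \<cdot> assoc C a b c) \<otimes> ident C d)
        \<cdot> inv_mor C (assoc C (a \<odot> b) c d)"
proof -
  let ?M = "(ident C a \<otimes> (braid C b c \<otimes> ident C d)) \<cdot> (ident C a \<otimes> inv_mor C (assoc C b c d))
      \<cdot> assoc C a b (c \<odot> d)"
  have "inv_mor C (assoc C (a \<odot> c) b d) \<cdot> interchange C a b c d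
    = inv_mor C (assoc C (a \<odot> c) b d) \<cdot> inv_mor C (assoc C a c (b \<odot> d)) \<cdot> (ident C a \<otimes> assoc C c b d) \<cdot> ?M"
    by (simp add: interchange_def tensor_comp_tensor_comp)
  also have "\<dots> = (inv_mor C (assoc C a c b) \<otimes> ident C d) \<cdot> inv_mor C (assoc C a (c \<odot> b) d) \<cdot> ?M"
    using arg_cong[OF pentagon_inv_left[of a c b d], of "\<lambda>f. f \<cdot> ?M"] by simp
  also have "inv_mor C (assoc C a (c \<odot> b) d) \<cdot> ?M
    = ((ident C a \<otimes> braid C b c) \<otimes> ident C d) \<cdot> inv_mor C (assoc C a (b \<odot> c) d)
        \<cdot> (ident C a \<otimes> inv_mor C (assoc C b c d)) \<cdot> assoc C a b (c \<odot> d)"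
    using comp_rewrite[OF tensor_comp_inv_assoc[of "ident C a" "braid C b c" "ident C d", symmetric],
        of "(ident C a \<otimes> inv_mor C (assoc C b c d)) \<cdot> assoc C a b (c \<odot> d)"]
    by simp
  also note pentagon_inv_right
  finally show ?thesis
    by (simp add: tensor_comp_tensor_comp)
qed

text \<open>Both sides realise the same permutation of four factors. The hexagon splits the large
  braiding into moving \<open>a \<odot> c\<close> past \<open>b\<close> and then past
  \<open>d\<close>. The first move undoes the braiding of \<open>b\<close> and \<open>c\<close> in
  the interchange and leaves \<open>braid C a b\<close>; the second yields
  \<open>braid C c d\<close> and the braiding of \<open>a\<close> and \<open>d\<close>.\<close>

lemma braid_comp_interchange:
  "braid C (a \<odot> c) (b \<odot> d) \<cdot> interchange C a b c d
    = interchange C b a d c \<cdot> (braid C a b \<otimes> braid C c d)"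
proof -
  let ?c = "braid C a b \<otimes> ident C (c \<odot> d)"
  have "(braid C (a \<odot> c) b \<otimes> ident C d) \<cdot> inv_mor C (assoc C (a \<odot> c) b d) \<cdot> interchange C a b c d
    = ((braid C (a \<odot> c) b \<cdot> inv_mor C (assoc C a c b) \<cdot> (ident C a \<otimes> braid C b c) \<cdot> assoc C a b c) \<otimes> ident C d)
        \<cdot> inv_mor C (assoc C (a \<odot> b) c d)"
    by (simp add: inv_assoc_comp_interchange tensor_comp_tensor_comp)
  also have "braid C (a \<odot> c) b \<cdot> inv_mor C (assoc C a c b) \<cdot> (ident C a \<otimes> braid C b c) \<cdot> assoc C a b c
    = assoc C b a c \<cdot> (braid C a b \<otimes> ident C c)"
    using comp_rewrite[OF braid_comp_inv_assoc[of a c b], of "(ident C a \<otimes> braid C b c) \<cdot> assoc C a b c"]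
    by (simp add: tensor_comp_tensor_comp)
  also have "((assoc C b a c \<cdot> (braid C a b \<otimes> ident C c)) \<otimes> ident C d) \<cdot> inv_mor C (assoc C (a \<odot> b) c d)
    = (assoc C b a c \<otimes> ident C d) \<cdot> ((braid C a b \<otimes> ident C c) \<otimes> ident C d) \<cdot> inv_mor C (assoc C (a \<odot> b) c d)"
    by (simp add: tensor_comp_tensor_comp)
  also have "((braid C a b \<otimes> ident C c) \<otimes> ident C d) \<cdot> inv_mor C (assoc C (a \<odot> b) c d)
    = inv_mor C (assoc C (b \<odot> a) c d) \<cdot> ?c"
    using tensor_comp_inv_assoc[of "braid C a b" "ident C c" "ident C d"] by simp
  finally have 1: "(braid C (a \<odot> c) b \<otimes> ident C d) \<cdot> inv_mor C (assoc C (a \<odot> c) b d) \<cdot> interchange C a b c d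
    = (assoc C b a c \<otimes> ident C d) \<cdot> inv_mor C (assoc C (b \<odot> a) c d) \<cdot> ?c" .
  have "braid C (a \<odot> c) (b \<odot> d) = inv_mor C (assoc C b d (a \<odot> c)) \<cdot> (ident C b \<otimes> braid C (a \<odot> c) d)
      \<cdot> assoc C b (a \<odot> c) d \<cdot> (braid C (a \<odot> c) b \<otimes> ident C d) \<cdot> inv_mor C (assoc C (a \<odot> c) b d)"
    using arg_cong[OF hexagon[of b d "a \<odot> c"], of "\<lambda>f. inv_mor C (assoc C b d (a \<odot> c)) \<cdot> f
        \<cdot> inv_mor C (assoc C (a \<odot> c) b d)"]
    by simp
  then have "braid C (a \<odot> c) (b \<odot> d) \<cdot> interchange C a b c d
    = inv_mor C (assoc C b d (a \<odot> c)) \<cdot> (ident C b \<otimes> braid C (a \<odot> c) d) \<cdot> assoc C b (a \<odot> c) d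
        \<cdot> (assoc C b a c \<otimes> ident C d) \<cdot> inv_mor C (assoc C (b \<odot> a) c d) \<cdot> ?c"
    using 1 by simp
  also have "assoc C b (a \<odot> c) d \<cdot> (assoc C b a c \<otimes> ident C d) \<cdot> inv_mor C (assoc C (b \<odot> a) c d) \<cdot> ?c
    = (ident C b \<otimes> inv_mor C (assoc C a c d)) \<cdot> assoc C b a (c \<odot> d) \<cdot> ?c"
    using arg_cong[OF pentagon_inv_right[of b a c d], of "\<lambda>f. assoc C b (a \<odot> c) d \<cdot> f \<cdot> ?c"] by simp
  also have "(ident C b \<otimes> braid C (a \<odot> c) d) \<cdot> (ident C b \<otimes> inv_mor C (assoc C a c d)) \<cdot> assoc C b a (c \<odot> d) \<cdot> ?c
    = (ident C b \<otimes> (braid C (a \<odot> c) d \<cdot> inv_mor C (assoc C a c d))) \<cdot> assoc C b a (c \<odot> d) \<cdot> ?c"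
    by (simp add: tensor_comp_tensor_comp)
  \<comment> \<open>The second hexagon splits the braiding with \<open>d\<close>; the part tensored
    with \<open>ident C b\<close> is now the core of \<open>interchange C b a d c\<close>.\<close>
  also have "\<dots> = (ident C b \<otimes> (assoc C d a c \<cdot> (braid C a d \<otimes> ident C c) \<cdot> inv_mor C (assoc C a d c)))
      \<cdot> (ident C b \<otimes> (ident C a \<otimes> braid C c d)) \<cdot> assoc C b a (c \<odot> d) \<cdot> ?c"
    by (simp add: tensor_comp_tensor_comp braid_comp_inv_assoc)
  also have "(ident C b \<otimes> (ident C a \<otimes> braid C c d)) \<cdot> assoc C b a (c \<odot> d) \<cdot> ?c
    = assoc C b a (d \<odot> c) \<cdot> (ident C (b \<odot> a) \<otimes> braid C c d) \<cdot> ?c"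
    using comp_rewrite[OF assoc_comp_tensor[of "ident C b" "ident C a" "braid C c d", symmetric], of ?c]
    by simp
  finally show ?thesis
    by (simp add: interchange_def tensor_comp_tensor)
qed

end


section \<open>Quadratic forms\<close>

context symmetric_tensor_category
begin

text \<open>Rigidity treats an epi to the right of an identity; braidings on both ends move the
  identity to the other side, and \<open>e \<otimes> f\<close> is a composite of the two
  kinds.\<close>

lemma epi_mor_tensor:
  assumes "epi_mor C e" "epi_mor C f"
  shows "epi_mor C (e \<otimes> f)"
proof -
  let ?b = "braid C (Cod C f) (Cod C e)" and ?b' = "braid C (Dom C e) (Cod C f)"
  have "epi_mor C ((ident C (Cod C f) \<otimes> e) \<cdot> ?b')"
    by (intro epi_mor_comp epi_mor_ident_tensor iso_mor_epi iso_mor_braid assms) auto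
  then have "epi_mor C (?b \<cdot> (ident C (Cod C f) \<otimes> e) \<cdot> ?b')"
    by (rule epi_mor_comp[OF _ iso_mor_epi[OF iso_mor_braid]]) auto
  moreover have "?b \<cdot> (ident C (Cod C f) \<otimes> e) \<cdot> ?b' = e \<otimes> ident C (Cod C f)"
    using comp_rewrite[OF braid_comp_tensor[of "ident C (Cod C f)" e], of ?b'] by simp
  ultimately have "epi_mor C ((e \<otimes> ident C (Cod C f)) \<cdot> (ident C (Dom C e) \<otimes> f))"
    by (intro epi_mor_comp epi_mor_ident_tensor assms) auto
  then show ?thesis
    by (simp add: tensor_comp_tensor)
qed

text \<open>The braiding is multiplicative on \<open>U \<odot> U\<close>: it passes
  \<open>\<mu> \<otimes> \<mu>\<close> by naturality and the middle braiding by
  \<open>braid_comp_interchange\<close>. Hence products of invariants are invariant.\<close>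

lemma braid_comp_mu_hat:
  assumes "is_algebra C U \<mu>"
  shows "braid C U U \<cdot> mu_hat C U \<mu> = mu_hat C U \<mu> \<cdot> (braid C U U \<otimes> braid C U U)"
proof -
  have [simp]: "Dom C \<mu> = U \<odot> U" "Cod C \<mu> = U"
    using assms by (auto simp: is_algebra_def hom_def)
  have mu_hat: "mu_hat C U \<mu> = (\<mu> \<otimes> \<mu>) \<cdot> interchange C U U U U"
    by (simp add: mu_hat_def middle_braid_def interchange_def)
  show ?thesis
    using comp_rewrite[OF braid_comp_tensor[of \<mu> \<mu>], of "interchange C U U U U"]
    by (simp add: mu_hat braid_comp_interchange)
qed

lemma Dom_mu_hat:
  assumes "is_algebra C U \<mu>"
  shows "Dom C (mu_hat C U \<mu>) = (U \<odot> U) \<odot> (U \<odot> U)" and "Cod C (mu_hat C U \<mu>) = U \<odot> U"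
  using assms by (auto simp: is_algebra_def hom_def mu_hat_def middle_braid_def)

section \<open>Invariants of the braiding and the morphisms they induce\<close>

lemma ident_hom_braid: "ident C (U \<odot> U) \<in> hom C (U \<odot> U) (U \<odot> U)"
    "braid C U U \<in> hom C (U \<odot> U) (U \<odot> U)"
  by (auto simp: hom_def)

lemma ident_diff_braid_comp_eq_zero_iff:
  assumes "Cod C g = U \<odot> U"
  shows "(ident C (U \<odot> U) \<ominus> braid C U U) \<cdot> g = zero_mor C (Dom C g) (U \<odot> U) \<longleftrightarrow> braid C U U \<cdot> g = g"
proof -
  have g: "g \<in> hom C (Dom C g) (U \<odot> U)"
    using assms by (simp add: hom_def)
  show ?thesis
    using comp_diff_left[OF ident_hom_braid g] diff_eq_zero_iff[OF g comp_hom[OF braid_hom g]] assms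
    by auto
qed

lemma comp_ident_diff_braid_eq_zero_iff:
  assumes "Dom C g = U \<odot> U"
  shows "g \<cdot> (ident C (U \<odot> U) \<ominus> braid C U U) = zero_mor C (U \<odot> U) (Cod C g) \<longleftrightarrow> g \<cdot> braid C U U = g"
proof -
  have g: "g \<in> hom C (U \<odot> U) (Cod C g)"
    using assms by (simp add: hom_def)
  show ?thesis
    using comp_diff_right[OF g ident_hom_braid] diff_eq_zero_iff[OF g comp_hom[OF g braid_hom]] assms
    by auto
qed

lemma Dom_ident_diff_braid [simp]: "Dom C (ident C (U \<odot> U) \<ominus> braid C U U) = U \<odot> U"
    "Cod C (ident C (U \<odot> U) \<ominus> braid C U U) = U \<odot> U"
  by (simp_all add: diff_mor_def)

text \<open>Replaces the kernel of a difference by invariants of the braiding, the form in which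
  \<open>rho\<close> and \<open>mu_tilde\<close> are constructed.\<close>

lemma is_Gamma2_iff:
  "is_Gamma2 C U \<iota> \<longleftrightarrow> Cod C \<iota> = U \<odot> U \<and> braid C U U \<cdot> \<iota> = \<iota>
    \<and> (\<forall>g. Cod C g = U \<odot> U \<and> braid C U U \<cdot> g = g \<longrightarrow> (\<exists>!h. h \<in> hom C (Dom C g) (Dom C \<iota>) \<and> \<iota> \<cdot> h = g))"
  unfolding is_Gamma2_def is_kernel_def
  by (simp add: ident_diff_braid_comp_eq_zero_iff cong: conj_cong)

lemma is_S2_iff:
  "is_S2 C U \<pi> \<longleftrightarrow> Dom C \<pi> = U \<odot> U \<and> \<pi> \<cdot> braid C U U = \<pi>
    \<and> (\<forall>g. Dom C g = U \<odot> U \<and> g \<cdot> braid C U U = g \<longrightarrow> (\<exists>!h. h \<in> hom C (Cod C \<pi>) (Cod C g) \<and> h \<cdot> \<pi> = g))"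
  unfolding is_S2_def is_cokernel_def
  by (simp add: comp_ident_diff_braid_eq_zero_iff cong: conj_cong)

text \<open>The braiding swaps the two summands because it squares to the identity; this lets the
  symmetrizer factor through \<open>\<iota>\<close>.\<close>

lemma braid_comp_ident_add_braid:
  "braid C U U \<cdot> (ident C (U \<odot> U) \<oplus> braid C U U) = ident C (U \<odot> U) \<oplus> braid C U U"
  using comp_add_right[OF braid_hom ident_hom_braid] add_comm[OF ident_hom_braid] by simp


lemma is_Gamma2_mono: "is_Gamma2 C U \<iota> \<Longrightarrow> mono_mor C \<iota>"
  unfolding is_Gamma2_def by (rule is_kernel_mono)

lemma is_Gamma2_factor:
  assumes "is_Gamma2 C U \<iota>" "Cod C g = U \<odot> U" "braid C U U \<cdot> g = g"
  shows "\<exists>!h. h \<in> hom C (Dom C g) (Dom C \<iota>) \<and> \<iota> \<cdot> h = g"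
  using assms by (simp add: is_Gamma2_iff)

lemma rho:
  assumes "is_Gamma2 C U \<iota>"
  shows Dom_rho: "Dom C (rho C U \<iota>) = U \<odot> U"
    and Cod_rho: "Cod C (rho C U \<iota>) = Dom C \<iota>"
    and Gamma2_comp_rho: "\<iota> \<cdot> rho C U \<iota> = ident C (U \<odot> U) \<oplus> braid C U U"
  using theI'[OF is_Gamma2_factor[OF assms _ braid_comp_ident_add_braid]]
  by (simp_all add: rho_def hom_def)

text \<open>Since \<open>\<iota> \<otimes> \<iota>\<close> absorbs a braiding in each factor and the
  braiding is multiplicative, the product of invariants factors uniquely through
  \<open>\<iota>\<close>.\<close>

lemma mu_tilde:
  assumes "is_algebra C U \<mu>" "is_Gamma2 C U \<iota>"
  shows Dom_mu_tilde: "Dom C (mu_tilde C U \<mu> \<iota>) = Dom C \<iota> \<odot> Dom C \<iota>"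
    and Cod_mu_tilde: "Cod C (mu_tilde C U \<mu> \<iota>) = Dom C \<iota>"
    and Gamma2_comp_mu_tilde: "\<iota> \<cdot> mu_tilde C U \<mu> \<iota> = mu_hat C U \<mu> \<cdot> (\<iota> \<otimes> \<iota>)"
proof -
  note [simp] = Dom_mu_hat[OF assms(1)]
  have \<iota> [simp]: "Cod C \<iota> = U \<odot> U" "braid C U U \<cdot> \<iota> = \<iota>"
    using assms(2) by (auto simp: is_Gamma2_iff)
  have "braid C U U \<cdot> (mu_hat C U \<mu> \<cdot> (\<iota> \<otimes> \<iota>)) = mu_hat C U \<mu> \<cdot> (\<iota> \<otimes> \<iota>)"
    using comp_rewrite[OF braid_comp_mu_hat[OF assms(1)], of "\<iota> \<otimes> \<iota>"]
    by (simp add: tensor_comp_tensor)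
  from theI'[OF is_Gamma2_factor[OF assms(2) _ this]]
  show "Dom C (mu_tilde C U \<mu> \<iota>) = Dom C \<iota> \<odot> Dom C \<iota>"
    "Cod C (mu_tilde C U \<mu> \<iota>) = Dom C \<iota>" "\<iota> \<cdot> mu_tilde C U \<mu> \<iota> = mu_hat C U \<mu> \<cdot> (\<iota> \<otimes> \<iota>)"
    by (simp_all add: mu_tilde_def hom_def)
qed

section \<open>The morphism \<open>rho\<close> is epi\<close>

text \<open>The braiding fixes \<open>\<iota>\<close>, so symmetrizing doubles it, and cancelling
  the mono \<open>\<iota>\<close> shows that \<open>rho\<close> after \<open>\<iota>\<close> is
  multiplication by 2. If \<open>t\<close> vanishes on \<open>rho\<close>, then
  \<open>2 \<star> t\<close> is zero, and 2 is invertible.\<close>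

lemma epi_mor_rho_if_not_char_2:
  assumes \<iota>: "is_Gamma2 C U \<iota>" and char: "CHAR('a) \<noteq> 2"
  shows "epi_mor C (rho C U \<iota>)"
proof -
  note [simp] = rho[OF \<iota>]
  have \<iota>' [simp]: "Cod C \<iota> = U \<odot> U" "braid C U U \<cdot> \<iota> = \<iota>"
    using \<iota> by (auto simp: is_Gamma2_iff)
  have \<iota>_hom: "\<iota> \<in> hom C (Dom C \<iota>) (U \<odot> U)"
    by (simp add: hom_def)
  \<comment> \<open>The scalar 2 vanishes exactly when the characteristic divides 2, and a field
    cannot have characteristic 1.\<close>
  have "\<not> CHAR('a) dvd 2"
  proof
    assume "CHAR('a) dvd 2"
    then have "CHAR('a) \<le> 2" "CHAR('a) \<noteq> 0"
      using dvd_imp_le[of "CHAR('a)" 2] by (simp, intro notI) simp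
    moreover have "CHAR('a) \<noteq> 1"
      by simp
    ultimately show False
      using char by linarith
  qed
  then have two: "(2::'a) \<noteq> 0"
    using of_nat_eq_0_iff_char_dvd[of 2, where 'a = 'a] by simp
  have "\<iota> \<cdot> (rho C U \<iota> \<cdot> \<iota>) = (ident C (U \<odot> U) \<oplus> braid C U U) \<cdot> \<iota>"
    by (rule comp_rewrite) auto
  also have "\<dots> = \<iota> \<oplus> \<iota>"
    using comp_add_left[OF ident_hom_braid \<iota>_hom] by simp
  also have "\<dots> = 2 \<star> \<iota>"
    using scale_add_left[OF \<iota>_hom, of 1 1] scale_one[OF \<iota>_hom] by simp
  also have "\<dots> = \<iota> \<cdot> (2 \<star> ident C (Dom C \<iota>))"
    using comp_scale_right[OF \<iota>_hom ident_hom] by simp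
  finally have rho_\<iota>: "rho C U \<iota> \<cdot> \<iota> = 2 \<star> ident C (Dom C \<iota>)"
    by (rule mono_morD[OF is_Gamma2_mono[OF \<iota>]]) simp_all
  show ?thesis
  proof (rule epi_morI)
    fix t assume t: "Dom C t = Cod C (rho C U \<iota>)"
      "t \<cdot> rho C U \<iota> = zero_mor C (Dom C (rho C U \<iota>)) (Cod C t)"
    have t_hom: "t \<in> hom C (Dom C \<iota>) (Cod C t)"
      using t by (simp add: hom_def)
    have "2 \<star> t = t \<cdot> (rho C U \<iota> \<cdot> \<iota>)"
      unfolding rho_\<iota> using comp_scale_right[OF t_hom ident_hom] t by simp
    also have "\<dots> = zero_mor C (Dom C \<iota>) (Cod C t)"
      using comp_rewrite[OF t(2), of \<iota>] t comp_zero_left by simp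
    finally have "(1/2) \<star> (2 \<star> t) = (1/2) \<star> zero_mor C (Dom C \<iota>) (Cod C t)"
      by simp
    then show "t = zero_mor C (Cod C (rho C U \<iota>)) (Cod C t)"
      using two scale_scale[OF t_hom] scale_one[OF t_hom] scale_zero_left[OF t_hom]
      by (metis Cod_rho[OF \<iota>] mult_zero_right nonzero_eq_divide_eq scale_scale t_hom)
  qed
qed

text \<open>
  When the Frobenius twist vanishes, \<open>\<pi> \<cdot> \<iota> = 0\<close>. In characteristic 2, a morphism annihilating
  \<open>\<iota> \<cdot> \<rho> = id + c\<close> factors through \<open>\<pi>\<close> and hence annihilates \<open>\<iota>\<close>, so no proper subobject of
  \<open>\<Gamma>\<^sup>2(U)\<close> contains the image of \<open>\<rho>\<close>.
\<close>

lemma epi_mor_rho_if_Frobenius_twist_zero: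
  assumes \<iota>: "is_Gamma2 C U \<iota>" and char: "CHAR('a) = 2"
    and twist: "is_Frobenius_twist C U T" "zero_object C T"
  shows "epi_mor C (rho C U \<iota>)"
proof -
  note [simp] = rho[OF \<iota>]
  have \<iota>' [simp]: "Cod C \<iota> = U \<odot> U" "braid C U U \<cdot> \<iota> = \<iota>"
    using \<iota> by (auto simp: is_Gamma2_iff)
  have "(2::'a) = 0"
    using of_nat_CHAR[where 'a = 'a] char by simp
  \<comment> \<open>Now \<open>id + c\<close> and \<open>id - c\<close> agree, which links
    \<open>rho\<close>, built from the sum, to the cokernel \<open>\<pi>\<close> of the
    difference.\<close>
  then have minus_one: "(- 1::'a) = 1"
    by (metis add_eq_0_iff one_add_one)
  obtain \<iota>\<^sub>0 \<pi> j where twist': "is_Gamma2 C U \<iota>\<^sub>0" "is_S2 C U \<pi>" "is_image C (\<pi> \<cdot> \<iota>\<^sub>0) j" "Dom C j = T"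
    using twist unfolding is_Frobenius_twist_def by blast
  have \<iota>\<^sub>0 [simp]: "Cod C \<iota>\<^sub>0 = U \<odot> U" and \<pi> [simp]: "Dom C \<pi> = U \<odot> U"
    using twist' by (auto simp: is_Gamma2_iff is_S2_iff)
  have "\<pi> \<cdot> \<iota>\<^sub>0 = zero_mor C (Dom C \<iota>\<^sub>0) (Cod C \<pi>)"
    using zero_mor_if_zero_object_image[OF twist'(3)] twist'(4) twist(2) by simp
  \<comment> \<open>The twist comes with its own choice \<open>\<iota>\<^sub>0\<close> of the
    divided square; the comparison \<open>s\<close> carries the vanishing over to
    \<open>\<iota>\<close>.\<close>
  moreover obtain s where "Dom C s = Dom C \<iota>" "Cod C s = Dom C \<iota>\<^sub>0" "\<iota>\<^sub>0 \<cdot> s = \<iota>"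
    using is_Gamma2_factor[OF twist'(1), of \<iota>] by (auto simp: hom_def)
  ultimately have \<pi>_\<iota>: "\<pi> \<cdot> \<iota> = zero_mor C (Dom C \<iota>) (Cod C \<pi>)"
    using comp_rewrite[of \<pi> \<iota>\<^sub>0 _ s] comp_zero_left[of s] by simp
  show ?thesis
  proof (rule epi_morI)
    fix t assume t: "Dom C t = Cod C (rho C U \<iota>)"
      "t \<cdot> rho C U \<iota> = zero_mor C (Dom C (rho C U \<iota>)) (Cod C t)"
    \<comment> \<open>The aim is a right inverse of the kernel \<open>k\<close> of \<open>t\<close>,
      which forces \<open>t\<close> to be zero. As \<open>t\<close> vanishes on \<open>rho\<close>,
      the latter factors through \<open>k\<close>.\<close>
    obtain k where k: "is_kernel C t k"
      using kernel_exists by blast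
    then have k_Cod [simp]: "Cod C k = Dom C \<iota>"
      and t_k: "t \<cdot> k = zero_mor C (Dom C k) (Cod C t)"
      using t by (auto simp: is_kernel_def)
    obtain r where r: "Dom C r = U \<odot> U" "Cod C r = Dom C k" "k \<cdot> r = rho C U \<iota>"
      using is_kernel_factor[OF k, of "rho C U \<iota>"] t by auto
    have "mono_mor C (\<iota> \<cdot> k)"
      by (rule mono_mor_comp[OF is_kernel_mono[OF k] is_Gamma2_mono[OF \<iota>]]) simp
    \<comment> \<open>In an abelian category the subobject \<open>\<iota> \<cdot> k\<close> of
      \<open>U \<odot> U\<close> is cut out by some \<open>p\<close>. Since \<open>id + c\<close>
      factors through it, \<open>p\<close> kills \<open>id + c\<close>.\<close>
    then obtain p where p: "is_kernel C p (\<iota> \<cdot> k)"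
      using mono_is_kernel by blast
    then have p_Dom [simp]: "Dom C p = U \<odot> U"
      and p_\<iota>_k: "p \<cdot> (\<iota> \<cdot> k) = zero_mor C (Dom C k) (Cod C p)"
      by (auto simp: is_kernel_def)
    have "p \<cdot> (ident C (U \<odot> U) \<oplus> braid C U U) = (p \<cdot> (\<iota> \<cdot> k)) \<cdot> r"
      using r by (simp flip: Gamma2_comp_rho[OF \<iota>])
    also have "\<dots> = zero_mor C (U \<odot> U) (Cod C p)"
      unfolding p_\<iota>_k using r comp_zero_left by simp
    finally have "p \<cdot> (ident C (U \<odot> U) \<ominus> braid C U U) = zero_mor C (U \<odot> U) (Cod C p)"
      by (simp add: diff_mor_def minus_one scale_one[OF braid_hom])
    then have "p \<cdot> braid C U U = p"
      by (simp add: comp_ident_diff_braid_eq_zero_iff)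
    then have "\<exists>!p'. p' \<in> hom C (Cod C \<pi>) (Cod C p) \<and> p' \<cdot> \<pi> = p"
      using twist'(2) unfolding is_S2_iff by simp
    then obtain p' where p': "Dom C p' = Cod C \<pi>" "Cod C p' = Cod C p" "p' \<cdot> \<pi> = p"
      by (auto simp: hom_def)
    \<comment> \<open>Factoring \<open>p\<close> through \<open>\<pi>\<close> shows that it kills
      all of \<open>\<iota>\<close>, so \<open>\<iota>\<close> in turn factors through
      \<open>\<iota> \<cdot> k\<close>.\<close>
    have "p \<cdot> \<iota> = p' \<cdot> (\<pi> \<cdot> \<iota>)"
      using p' by (metis comp_assoc_eq \<iota>'(1) \<pi>)
    also have "\<dots> = zero_mor C (Dom C \<iota>) (Cod C p)"
      unfolding \<pi>_\<iota> using p' by (simp add: comp_zero_right)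
    finally obtain v where v: "Dom C v = Dom C \<iota>" "Cod C v = Dom C k" "(\<iota> \<cdot> k) \<cdot> v = \<iota>"
      using is_kernel_factor[OF p, of \<iota>] by auto
    have "k \<cdot> v = ident C (Dom C \<iota>)"
      by (rule mono_morD[OF is_Gamma2_mono[OF \<iota>]]) (use v in simp_all)
    then have "t = t \<cdot> (k \<cdot> v)"
      using t by simp
    also have "\<dots> = zero_mor C (Dom C \<iota>) (Cod C t)"
      using comp_rewrite[OF t_k, of v] v t comp_zero_left by simp
    finally show "t = zero_mor C (Cod C (rho C U \<iota>)) (Cod C t)"
      by simp
  qed
qed

text \<open>It suffices to compare after the mono \<open>\<iota>\<close>, which turns
  \<open>rho\<close> into the symmetrizer \<open>id + c\<close>. Symmetrizing a product whose left
  factor is already symmetrized amounts to symmetrizing both factors.\<close>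

lemma rho_comp_mu_hat:
  assumes \<mu>: "is_algebra C U \<mu>" and \<iota>: "is_Gamma2 C U \<iota>"
  shows "rho C U \<iota> \<cdot> mu_hat C U \<mu> \<cdot> ((ident C (U \<odot> U) \<oplus> braid C U U) \<otimes> ident C (U \<odot> U))
    = mu_tilde C U \<mu> \<iota> \<cdot> (rho C U \<iota> \<otimes> rho C U \<iota>)"
proof -
  note [simp] = rho[OF \<iota>] Dom_mu_hat[OF \<mu>] Dom_mu_tilde[OF \<mu> \<iota>] Cod_mu_tilde[OF \<mu> \<iota>]
  have [simp]: "Cod C \<iota> = U \<odot> U"
    using \<iota> by (auto simp: is_Gamma2_iff)
  define sym where "sym = ident C (U \<odot> U) \<oplus> braid C U U"
  have sym [simp]: "Dom C sym = U \<odot> U" "Cod C sym = U \<odot> U" "braid C U U \<cdot> sym = sym"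
    by (simp_all add: sym_def braid_comp_ident_add_braid)
  have sym_hom: "sym \<in> hom C (U \<odot> U) (U \<odot> U)"
    by (simp add: hom_def)
  define X where "X = mu_hat C U \<mu> \<cdot> (sym \<otimes> ident C (U \<odot> U))"
  have X_hom: "X \<in> hom C ((U \<odot> U) \<odot> (U \<odot> U)) (U \<odot> U)"
    by (simp add: X_def hom_def)
  then have [simp]: "Dom C X = (U \<odot> U) \<odot> (U \<odot> U)" "Cod C X = U \<odot> U"
    by (auto simp: hom_def)
  have mu_hat_hom: "mu_hat C U \<mu> \<in> hom C ((U \<odot> U) \<odot> (U \<odot> U)) (U \<odot> U)"
    by (simp add: hom_def)
  have "\<iota> \<cdot> (rho C U \<iota> \<cdot> X) = sym \<cdot> X"
    by (rule comp_rewrite) (auto simp: sym_def)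
  also have "\<dots> = X \<oplus> braid C U U \<cdot> X"
    using comp_add_left[OF ident_hom_braid X_hom] by (simp add: sym_def)
  \<comment> \<open>Multiplicativity puts a braiding on both tensor factors and \<open>sym\<close>
    absorbs the left one. The two summands then differ only in the right factor and add up to
    \<open>sym \<otimes> sym\<close>.\<close>
  also have "braid C U U \<cdot> X = mu_hat C U \<mu> \<cdot> (sym \<otimes> braid C U U)"
    using comp_rewrite[OF braid_comp_mu_hat[OF \<mu>], of "sym \<otimes> ident C (U \<odot> U)"]
    by (simp add: X_def tensor_comp_tensor)
  also have "X \<oplus> mu_hat C U \<mu> \<cdot> (sym \<otimes> braid C U U)
      = mu_hat C U \<mu> \<cdot> ((sym \<otimes> ident C (U \<odot> U)) \<oplus> (sym \<otimes> braid C U U))"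
    unfolding X_def
    by (rule comp_add_right[OF mu_hat_hom, symmetric]) (auto simp: hom_def)
  also have "(sym \<otimes> ident C (U \<odot> U)) \<oplus> (sym \<otimes> braid C U U) = sym \<otimes> sym"
    by (rule tensor_add_right[OF sym_hom ident_hom_braid[of U], folded sym_def, symmetric])
  also have "mu_hat C U \<mu> \<cdot> (sym \<otimes> sym) = mu_hat C U \<mu> \<cdot> ((\<iota> \<otimes> \<iota>) \<cdot> (rho C U \<iota> \<otimes> rho C U \<iota>))"
    by (simp add: tensor_comp_tensor sym_def)
  also have "\<dots> = \<iota> \<cdot> (mu_tilde C U \<mu> \<iota> \<cdot> (rho C U \<iota> \<otimes> rho C U \<iota>))"
    using comp_rewrite[OF Gamma2_comp_mu_tilde[OF \<mu> \<iota>], of "rho C U \<iota> \<otimes> rho C U \<iota>"] by simp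
  finally have "rho C U \<iota> \<cdot> X = mu_tilde C U \<mu> \<iota> \<cdot> (rho C U \<iota> \<otimes> rho C U \<iota>)"
    by (rule mono_morD[OF is_Gamma2_mono[OF \<iota>]]) simp_all
  then show ?thesis
    by (simp add: X_def sym_def)
qed

end

theorem proposition3p7:
  fixes C :: "('k::field, 'o, 'm) tensor_category_data" (structure)
    and U :: 'o and \<mu> \<iota> Q B :: 'm
  assumes "symmetric_tensor_category C"
    and "is_algebra C U \<mu>"
    and "is_Gamma2 C U \<iota>"
    and "is_quadratic_form C \<iota> Q"
    and "B = bilinear_form C U \<iota> Q"
    and "CHAR('k) \<noteq> 2 \<or>
         CHAR('k) = 2 \<and> (\<exists>T. is_Frobenius_twist C U T \<and> zero_object C T)"
    and "tensor_form C B B =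
         B \<cdot> mu_hat C U \<mu> \<cdot> ((ident C (U \<odot> U) \<oplus> braid C U U) \<otimes> ident C (U \<odot> U))"
  shows "tensor_form C Q Q = Q \<cdot> mu_tilde C U \<mu> \<iota>"
proof -
  interpret symmetric_tensor_category C by fact
  let ?\<rho> = "rho C U \<iota>"
  note [simp] = rho[OF assms(3)] Dom_mu_hat[OF assms(2)]
    Dom_mu_tilde[OF assms(2,3)] Cod_mu_tilde[OF assms(2,3)]
  have Q [simp]: "Dom C Q = Dom C \<iota>" "Cod C Q = \<one>"
    using assms(4) by (auto simp: is_quadratic_form_def hom_def)
  have B: "B = Q \<cdot> ?\<rho>"
    using assms(5) by (simp add: bilinear_form_def)
  have "epi_mor C ?\<rho>"
    using assms(3,6) epi_mor_rho_if_not_char_2 epi_mor_rho_if_Frobenius_twist_zero by blast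
  then have epi: "epi_mor C (?\<rho> \<otimes> ?\<rho>)"
    by (intro epi_mor_tensor)
  \<comment> \<open>Because \<open>B\<close> is \<open>Q\<close> after \<open>rho\<close>,
    precomposing with the epi \<open>?\<rho> \<otimes> ?\<rho>\<close> turns the two sides of the
    claim into the two sides of the linearized identity.\<close>
  have "tensor_form C Q Q \<cdot> (?\<rho> \<otimes> ?\<rho>) = tensor_form C B B"
    by (simp add: tensor_form_def B tensor_comp_tensor)
  also have "\<dots> = Q \<cdot> (?\<rho> \<cdot> mu_hat C U \<mu> \<cdot> ((ident C (U \<odot> U) \<oplus> braid C U U) \<otimes> ident C (U \<odot> U)))"
    unfolding assms(7) by (simp add: B)
  also have "\<dots> = (Q \<cdot> mu_tilde C U \<mu> \<iota>) \<cdot> (?\<rho> \<otimes> ?\<rho>)"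
    unfolding rho_comp_mu_hat[OF assms(2,3)] by simp
  finally show ?thesis
    by (rule epi_morD[OF epi]) (auto simp: tensor_form_def)
qed

end
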